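(* Let $M$ be a nonempty smooth manifold of positive dimension and let $(M,J,g)$ be an $(\alpha,\varepsilon)$-metric manifold with $\alpha=-1$. Then the induced generalized almost complex structures $$\mathcal J_{J,g,\flat}=\begin{pmatrix}J&0\\ \flat_g&\varepsilon J^*\end{pmatrix},\qquad \mathcal J_{J,g,\sharp}=\begin{pmatrix}J&\sharp_g\\0&\varepsilon J^*\end{pmatrix}$$ on $\mathbb TM=TM\oplus T^*M$ are compatible with the natural generalized metric $\mathcal G_0$ if and only if $\varepsilon=+1$, that is, if and only if $(M,J,g)$ is an almost Hermitian or indefinite almost Hermitian manifold (depending on $g$). In this case, each of $(\mathcal J_{J,g,\flat},\mathcal G_0)$ and $(\mathcal J_{J,g,\sharp},\mathcal G_0)$ is a generalized almost Norden structure, with twin metrics $$\Phi_{\mathcal J_{J,g,\flat}}(X+\xi,Y+\eta)=\mathcal G_0(JX+\xi,JY+\eta)+\tfrac12 g(X,Y),$$ $$\Phi_{\mathcal J_{J,g,\sharp}}(X+\xi,Y+\eta)=\mathcal G_0(JX+\xi,JY+\eta)+\tfrac12 g(\sharp_g\xi,\sharp_g\eta)$$ for all $X,Y\in\mathfrak X(M)$, $\xi,\eta\in\Lambda^1(M)$.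
   Context: An $(\alpha,\varepsilon)$-metric manifold $(M,J,g)$, $\alpha,\varepsilon\in\{+1,-1\}$, is a smooth manifold with a Riemannian or pseudo-Riemannian (i.e. nondegenerate, not positive definite) metric $g$ and an $\mathfrak F(M)$-linear $J\colon\mathfrak X(M)\to\mathfrak X(M)$ with $J^2=\alpha Id$ and $g(JX,JY)=\varepsilon g(X,Y)$ for all $X,Y$. For $\alpha=-1,\varepsilon=+1$ it is called almost Hermitian (resp. indefinite almost Hermitian) if $g$ is Riemannian (resp. pseudo-Riemannian). $\mathfrak F(M)$, $\mathfrak X(M)$, $\Lambda^1(M)$ denote smooth functions, vector fields, 1-forms; sections of $\mathbb TM$ are written $X+\xi$. $(\flat_gX)(Y)=g(X,Y)$, $\sharp_g=\flat_g^{-1}$, $(J^*\xi)(X)=\xi(JX)$. Matrix notation: $\begin{pmatrix}H&\sigma\\ \tau&K\end{pmatrix}(X+\xi)=(HX+\sigma\xi)+(\tau X+K\xi)$. A generalized almost complex structure is an $\mathfrak F(M)$-linear endomorphism $\mathcal J$ of $\Gamma(\mathbb TM)$ with $\mathcal J^2=-Id$. $\mathcal G_0(X+\xi,Y+\eta)=\frac12(\xi(Y)+\eta(X))$. An endomorphism $\mathcal K$ is compatible with a metric $\mathcal G$ on $\mathbb TM$ if there is $\delta\in\{+1,-1\}$ with $\mathcal G(\mathcal Ku,\mathcal Kv)=\delta\,\mathcal G(u,v)$ for all sections $u,v$. $(\mathcal J,\mathcal G)$ with $\mathcal J^2=-Id$ is generalized almost Norden if $\mathcal G(\mathcal Ju,\mathcal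 Jv)=-\mathcal G(u,v)$ for all $u,v$; its twin metric is $\Phi_{\mathcal J}(u,v)=\mathcal G(\mathcal Ju,v)$. *)

theory Defs
  imports "HOL-Analysis.Analysis"
begin

section \<open>Smooth manifolds\<close>

text \<open>\<open>Ck_on\<close> and \<open>smooth_on\<close> are meant for open sets \<open>S\<close>; there they do not depend on the
  values of \<open>f\<close> outside \<open>S\<close>.\<close>

primrec Ck_on :: "nat \<Rightarrow> 'a::euclidean_space set \<Rightarrow> ('a \<Rightarrow> 'b::real_normed_vector) \<Rightarrow> bool" where
  "Ck_on 0 S f \<longleftrightarrow> continuous_on S f"
| "Ck_on (Suc k) S f \<longleftrightarrow>
     (\<forall>x\<in>S. f differentiable (at x)) \<and> (\<forall>v. Ck_on k S (\<lambda>x. frechet_derivative f (at x) v))"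

definition smooth_on :: "'a::euclidean_space set \<Rightarrow> ('a \<Rightarrow> 'b::real_normed_vector) \<Rightarrow> bool" where
  "smooth_on S f \<longleftrightarrow> (\<forall>k. Ck_on k S f)"

text \<open>A chart is a pair \<open>(U, \<phi>)\<close>; only the values of \<open>\<phi>\<close> on \<open>U\<close> matter. The dimension of the
  manifold is \<open>CARD('n)\<close>, which is positive for every type \<open>'n\<close>.\<close>

type_synonym ('a, 'n) chart = "'a set \<times> ('a \<Rightarrow> real ^ 'n)"

record ('a, 'n) manifold =
  mtop :: "'a topology"
  atlas :: "('a, 'n) chart set"

definition points :: "('a, 'n::finite) manifold \<Rightarrow> 'a set" where
  "points M = topspace (mtop M)"

definition chart_image :: "('a, 'n::finite) chart \<Rightarrow> (real ^ 'n) set" where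
  "chart_image c = snd c ` fst c"

definition chart_inv :: "('a, 'n::finite) chart \<Rightarrow> real ^ 'n \<Rightarrow> 'a" where
  "chart_inv c = inv_into (fst c) (snd c)"

definition is_chart :: "'a topology \<Rightarrow> ('a, 'n::finite) chart \<Rightarrow> bool" where
  "is_chart T c \<longleftrightarrow> openin T (fst c) \<and> open (chart_image c) \<and>
     homeomorphic_map (subtopology T (fst c)) (top_of_set (chart_image c)) (snd c)"

definition smooth_manifold :: "('a, 'n::finite) manifold \<Rightarrow> bool" where
  "smooth_manifold M \<longleftrightarrow>
     Hausdorff_space (mtop M) \<and> second_countable (mtop M) \<and>
     (\<forall>c\<in>atlas M. is_chart (mtop M) c) \<and>
     (\<Union>c\<in>atlas M. fst c) = points M \<and>
     (\<forall>c\<in>atlas M. \<forall>d\<in>atlas M. smooth_on (snd c ` (fst c \<inter> fst d)) (snd d \<circ> chart_inv c))"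

text \<open>Scalar functions on \<open>M\<close> are represented by total functions vanishing off \<open>points M\<close>.\<close>

definition smooth_funs :: "('a, 'n::finite) manifold \<Rightarrow> ('a \<Rightarrow> real) set" where
  "smooth_funs M = {f. (\<forall>p. p \<notin> points M \<longrightarrow> f p = 0) \<and>
     (\<forall>c\<in>atlas M. smooth_on (chart_image c) (f \<circ> chart_inv c))}"


section \<open>Tangent vectors, vector fields and 1-forms\<close>

text \<open>A tangent vector at \<open>p\<close> is an equivalence class of pairs (chart \<open>c\<close> around \<open>p\<close>, vector of
  \<open>\<real>\<^sup>n\<close>) under the derivatives of the coordinate changes. The class is encoded as the function
  sending \<open>c\<close> to its representative, and every other argument to 0.\<close>

type_synonym ('a, 'n) tvec = "('a, 'n) chart \<Rightarrow> real ^ 'n"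

definition charts_at :: "('a, 'n::finite) manifold \<Rightarrow> 'a \<Rightarrow> ('a, 'n) chart set" where
  "charts_at M p = {c \<in> atlas M. p \<in> fst c}"

definition transition_deriv ::
  "('a, 'n::finite) chart \<Rightarrow> ('a, 'n) chart \<Rightarrow> 'a \<Rightarrow> real ^ 'n \<Rightarrow> real ^ 'n" where
  "transition_deriv c d p = frechet_derivative (snd d \<circ> chart_inv c) (at (snd c p))"

definition tangent_space :: "('a, 'n::finite) manifold \<Rightarrow> 'a \<Rightarrow> ('a, 'n) tvec set" where
  "tangent_space M p = {v. (\<forall>c. c \<notin> charts_at M p \<longrightarrow> v c = 0) \<and>
     (\<forall>c\<in>charts_at M p. \<forall>d\<in>charts_at M p. v d = transition_deriv c d p (v c))}"

definition tzero :: "('a, 'n::finite) tvec" where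
  "tzero = (\<lambda>c. 0)"

definition tadd :: "('a, 'n::finite) tvec \<Rightarrow> ('a, 'n) tvec \<Rightarrow> ('a, 'n) tvec" where
  "tadd v w = (\<lambda>c. v c + w c)"

definition tscale :: "real \<Rightarrow> ('a, 'n::finite) tvec \<Rightarrow> ('a, 'n) tvec" where
  "tscale r v = (\<lambda>c. r *\<^sub>R v c)"

text \<open>The tangent vector at \<open>p\<close> with components \<open>w\<close> in the chart \<open>c\<close>.\<close>

definition coord_vec ::
  "('a, 'n::finite) manifold \<Rightarrow> ('a, 'n) chart \<Rightarrow> 'a \<Rightarrow> real ^ 'n \<Rightarrow> ('a, 'n) tvec" where
  "coord_vec M c p w = (\<lambda>d. if d \<in> charts_at M p then transition_deriv c d p w else 0)"

definition cotangent_space ::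
  "('a, 'n::finite) manifold \<Rightarrow> 'a \<Rightarrow> (('a, 'n) tvec \<Rightarrow> real) set" where
  "cotangent_space M p = {a.
     (\<forall>v\<in>tangent_space M p. \<forall>w\<in>tangent_space M p. a (tadd v w) = a v + a w) \<and>
     (\<forall>r. \<forall>v\<in>tangent_space M p. a (tscale r v) = r * a v) \<and>
     (\<forall>v. v \<notin> tangent_space M p \<longrightarrow> a v = 0)}"

text \<open>For \<open>p \<notin> points M\<close> there is no chart around \<open>p\<close>, so both spaces above contain only 0
  and the sections below vanish off \<open>points M\<close>.\<close>

type_synonym ('a, 'n) vfield = "'a \<Rightarrow> ('a, 'n) tvec"
type_synonym ('a, 'n) form = "'a \<Rightarrow> ('a, 'n) tvec \<Rightarrow> real"

definition vfields :: "('a, 'n::finite) manifold \<Rightarrow> ('a, 'n) vfield set" where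
  "vfields M = {X. (\<forall>p. X p \<in> tangent_space M p) \<and>
     (\<forall>c\<in>atlas M. smooth_on (chart_image c) (\<lambda>x. X (chart_inv c x) c))}"

definition one_forms :: "('a, 'n::finite) manifold \<Rightarrow> ('a, 'n) form set" where
  "one_forms M = {\<xi>. (\<forall>p. \<xi> p \<in> cotangent_space M p) \<and>
     (\<forall>c\<in>atlas M. \<forall>w. smooth_on (chart_image c)
        (\<lambda>x. \<xi> (chart_inv c x) (coord_vec M c (chart_inv c x) w)))}"

definition vf_add :: "('a, 'n::finite) vfield \<Rightarrow> ('a, 'n) vfield \<Rightarrow> ('a, 'n) vfield" where
  "vf_add X Y = (\<lambda>p. tadd (X p) (Y p))"

definition vf_scale :: "('a \<Rightarrow> real) \<Rightarrow> ('a, 'n::finite) vfield \<Rightarrow> ('a, 'n) vfield" where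
  "vf_scale f X = (\<lambda>p. tscale (f p) (X p))"

definition form_add :: "('a, 'n::finite) form \<Rightarrow> ('a, 'n) form \<Rightarrow> ('a, 'n) form" where
  "form_add \<xi> \<eta> = (\<lambda>p v. \<xi> p v + \<eta> p v)"

definition form_scale :: "('a \<Rightarrow> real) \<Rightarrow> ('a, 'n::finite) form \<Rightarrow> ('a, 'n) form" where
  "form_scale f \<xi> = (\<lambda>p v. f p * \<xi> p v)"

definition form_app :: "('a, 'n::finite) form \<Rightarrow> ('a, 'n) vfield \<Rightarrow> 'a \<Rightarrow> real" where
  "form_app \<xi> X = (\<lambda>p. \<xi> p (X p))"

definition vf_endo :: "('a, 'n::finite) manifold \<Rightarrow> (('a, 'n) vfield \<Rightarrow> ('a, 'n) vfield) \<Rightarrow> bool" where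
  "vf_endo M H \<longleftrightarrow>
     (\<forall>X\<in>vfields M. H X \<in> vfields M) \<and>
     (\<forall>X\<in>vfields M. \<forall>Y\<in>vfields M. H (vf_add X Y) = vf_add (H X) (H Y)) \<and>
     (\<forall>f\<in>smooth_funs M. \<forall>X\<in>vfields M. H (vf_scale f X) = vf_scale f (H X))"

definition dual_endo ::
  "('a, 'n::finite) manifold \<Rightarrow> (('a, 'n) vfield \<Rightarrow> ('a, 'n) vfield) \<Rightarrow> ('a, 'n) form \<Rightarrow> ('a, 'n) form" where
  "dual_endo M J \<xi> =
     (THE \<zeta>. \<zeta> \<in> one_forms M \<and> (\<forall>X\<in>vfields M. form_app \<zeta> X = form_app \<xi> (J X)))"


section \<open>Metrics and metric manifolds\<close>

type_synonym ('a, 'n) tensor2 = "'a \<Rightarrow> ('a, 'n) tvec \<Rightarrow> ('a, 'n) tvec \<Rightarrow> real"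

definition symmetric_tensor :: "('a, 'n::finite) manifold \<Rightarrow> ('a, 'n) tensor2 \<Rightarrow> bool" where
  "symmetric_tensor M g \<longleftrightarrow>
     (\<forall>p\<in>points M. \<forall>u\<in>tangent_space M p. \<forall>v\<in>tangent_space M p. \<forall>w\<in>tangent_space M p.
        g p (tadd u v) w = g p u w + g p v w) \<and>
     (\<forall>p\<in>points M. \<forall>r. \<forall>v\<in>tangent_space M p. \<forall>w\<in>tangent_space M p.
        g p (tscale r v) w = r * g p v w) \<and>
     (\<forall>p\<in>points M. \<forall>v\<in>tangent_space M p. \<forall>w\<in>tangent_space M p. g p v w = g p w v) \<and>
     (\<forall>c\<in>atlas M. \<forall>v w. smooth_on (chart_image c)
        (\<lambda>x. g (chart_inv c x) (coord_vec M c (chart_inv c x) v) (coord_vec M c (chart_inv c x) w)))"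

definition nondegenerate :: "('a, 'n::finite) manifold \<Rightarrow> ('a, 'n) tensor2 \<Rightarrow> bool" where
  "nondegenerate M g \<longleftrightarrow> (\<forall>p\<in>points M. \<forall>v\<in>tangent_space M p.
     (\<forall>w\<in>tangent_space M p. g p v w = 0) \<longrightarrow> v = tzero)"

definition positive_definite :: "('a, 'n::finite) manifold \<Rightarrow> ('a, 'n) tensor2 \<Rightarrow> bool" where
  "positive_definite M g \<longleftrightarrow> (\<forall>p\<in>points M. \<forall>v\<in>tangent_space M p. v \<noteq> tzero \<longrightarrow> g p v v > 0)"

definition riemannian :: "('a, 'n::finite) manifold \<Rightarrow> ('a, 'n) tensor2 \<Rightarrow> bool" where
  "riemannian M g \<longleftrightarrow> symmetric_tensor M g \<and> positive_definite M g"

definition pseudo_riemannian :: "('a, 'n::finite) manifold \<Rightarrow> ('a, 'n) tensor2 \<Rightarrow> bool" where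
  "pseudo_riemannian M g \<longleftrightarrow> symmetric_tensor M g \<and> nondegenerate M g \<and> \<not> positive_definite M g"

definition metric_app ::
  "('a, 'n::finite) manifold \<Rightarrow> ('a, 'n) tensor2 \<Rightarrow> ('a, 'n) vfield \<Rightarrow> ('a, 'n) vfield \<Rightarrow> 'a \<Rightarrow> real" where
  "metric_app M g X Y = (\<lambda>p. if p \<in> points M then g p (X p) (Y p) else 0)"

definition flat :: "('a, 'n::finite) manifold \<Rightarrow> ('a, 'n) tensor2 \<Rightarrow> ('a, 'n) vfield \<Rightarrow> ('a, 'n) form" where
  "flat M g X = (\<lambda>p v. if p \<in> points M \<and> v \<in> tangent_space M p then g p (X p) v else 0)"

definition sharp :: "('a, 'n::finite) manifold \<Rightarrow> ('a, 'n) tensor2 \<Rightarrow> ('a, 'n) form \<Rightarrow> ('a, 'n) vfield" where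
  "sharp M g = inv_into (vfields M) (flat M g)"

definition metric_manifold ::
  "real \<Rightarrow> real \<Rightarrow> ('a, 'n::finite) manifold \<Rightarrow> (('a, 'n) vfield \<Rightarrow> ('a, 'n) vfield) \<Rightarrow>
   ('a, 'n) tensor2 \<Rightarrow> bool" where
  "metric_manifold \<alpha> \<epsilon> M J g \<longleftrightarrow>
     \<alpha> \<in> {1, -1} \<and> \<epsilon> \<in> {1, -1} \<and> smooth_manifold M \<and>
     (riemannian M g \<or> pseudo_riemannian M g) \<and>
     vf_endo M J \<and>
     (\<forall>X\<in>vfields M. J (J X) = vf_scale (\<lambda>p. \<alpha>) X) \<and>
     (\<forall>X\<in>vfields M. \<forall>Y\<in>vfields M. metric_app M g (J X) (J Y) = (\<lambda>p. \<epsilon> * metric_app M g X Y p))"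

definition almost_hermitian ::
  "('a, 'n::finite) manifold \<Rightarrow> (('a, 'n) vfield \<Rightarrow> ('a, 'n) vfield) \<Rightarrow> ('a, 'n) tensor2 \<Rightarrow> bool" where
  "almost_hermitian M J g \<longleftrightarrow> metric_manifold (-1) 1 M J g \<and> riemannian M g"

definition indefinite_almost_hermitian ::
  "('a, 'n::finite) manifold \<Rightarrow> (('a, 'n) vfield \<Rightarrow> ('a, 'n) vfield) \<Rightarrow> ('a, 'n) tensor2 \<Rightarrow> bool" where
  "indefinite_almost_hermitian M J g \<longleftrightarrow> metric_manifold (-1) 1 M J g \<and> pseudo_riemannian M g"


section \<open>The generalized tangent bundle\<close>

text \<open>The section \<open>X + \<xi>\<close> of \<open>TM \<oplus> T\<^sup>*M\<close> is the pair \<open>(X, \<xi>)\<close>.\<close>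

type_synonym ('a, 'n) gsection = "('a, 'n) vfield \<times> ('a, 'n) form"

definition gsections :: "('a, 'n::finite) manifold \<Rightarrow> ('a, 'n) gsection set" where
  "gsections M = vfields M \<times> one_forms M"

definition gs_add :: "('a, 'n::finite) gsection \<Rightarrow> ('a, 'n) gsection \<Rightarrow> ('a, 'n) gsection" where
  "gs_add u v = (vf_add (fst u) (fst v), form_add (snd u) (snd v))"

definition gs_scale :: "('a \<Rightarrow> real) \<Rightarrow> ('a, 'n::finite) gsection \<Rightarrow> ('a, 'n) gsection" where
  "gs_scale f u = (vf_scale f (fst u), form_scale f (snd u))"

definition gs_endo ::
  "('a, 'n::finite) manifold \<Rightarrow> (('a, 'n) gsection \<Rightarrow> ('a, 'n) gsection) \<Rightarrow> bool" where
  "gs_endo M K \<longleftrightarrow>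
     (\<forall>u\<in>gsections M. K u \<in> gsections M) \<and>
     (\<forall>u\<in>gsections M. \<forall>v\<in>gsections M. K (gs_add u v) = gs_add (K u) (K v)) \<and>
     (\<forall>f\<in>smooth_funs M. \<forall>u\<in>gsections M. K (gs_scale f u) = gs_scale f (K u))"

definition gen_almost_complex ::
  "('a, 'n::finite) manifold \<Rightarrow> (('a, 'n) gsection \<Rightarrow> ('a, 'n) gsection) \<Rightarrow> bool" where
  "gen_almost_complex M K \<longleftrightarrow> gs_endo M K \<and> (\<forall>u\<in>gsections M. K (K u) = gs_scale (\<lambda>p. -1) u)"

type_synonym ('a, 'n) gbilinear = "('a, 'n) gsection \<Rightarrow> ('a, 'n) gsection \<Rightarrow> 'a \<Rightarrow> real"

definition gen_metric :: "('a, 'n::finite) manifold \<Rightarrow> ('a, 'n) gbilinear \<Rightarrow> bool" where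
  "gen_metric M G \<longleftrightarrow>
     (\<forall>u\<in>gsections M. \<forall>v\<in>gsections M. G u v \<in> smooth_funs M) \<and>
     (\<forall>u\<in>gsections M. \<forall>v\<in>gsections M. \<forall>w\<in>gsections M.
        G (gs_add u v) w = (\<lambda>p. G u w p + G v w p)) \<and>
     (\<forall>f\<in>smooth_funs M. \<forall>u\<in>gsections M. \<forall>v\<in>gsections M.
        G (gs_scale f u) v = (\<lambda>p. f p * G u v p)) \<and>
     (\<forall>u\<in>gsections M. \<forall>v\<in>gsections M. G u v = G v u) \<and>
     (\<forall>p\<in>points M. \<forall>u\<in>gsections M. (\<forall>v\<in>gsections M. G u v p = 0) \<longrightarrow>
        fst u p = tzero \<and> snd u p = (\<lambda>v. 0))"

definition G0 :: "('a, 'n::finite) gbilinear" where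
  "G0 u v = (\<lambda>p. 1 / 2 * (form_app (snd u) (fst v) p + form_app (snd v) (fst u) p))"

definition compatible ::
  "('a, 'n::finite) manifold \<Rightarrow> (('a, 'n) gsection \<Rightarrow> ('a, 'n) gsection) \<Rightarrow> ('a, 'n) gbilinear \<Rightarrow> bool" where
  "compatible M K G \<longleftrightarrow> gs_endo M K \<and> gen_metric M G \<and>
     (\<exists>\<delta>::real. \<delta> \<in> {1, -1} \<and>
        (\<forall>u\<in>gsections M. \<forall>v\<in>gsections M. G (K u) (K v) = (\<lambda>p. \<delta> * G u v p)))"

definition gen_almost_norden ::
  "('a, 'n::finite) manifold \<Rightarrow> (('a, 'n) gsection \<Rightarrow> ('a, 'n) gsection) \<Rightarrow> ('a, 'n) gbilinear \<Rightarrow> bool" where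
  "gen_almost_norden M K G \<longleftrightarrow> gen_almost_complex M K \<and> gen_metric M G \<and>
     (\<forall>u\<in>gsections M. \<forall>v\<in>gsections M. G (K u) (K v) = (\<lambda>p. - G u v p))"

definition twin_metric ::
  "(('a, 'n::finite) gsection \<Rightarrow> ('a, 'n) gsection) \<Rightarrow> ('a, 'n) gbilinear \<Rightarrow> ('a, 'n) gbilinear" where
  "twin_metric K G u v = G (K u) v"

definition matrix_endo ::
  "(('a, 'n::finite) vfield \<Rightarrow> ('a, 'n) vfield) \<Rightarrow> (('a, 'n) form \<Rightarrow> ('a, 'n) vfield) \<Rightarrow>
   (('a, 'n) vfield \<Rightarrow> ('a, 'n) form) \<Rightarrow> (('a, 'n) form \<Rightarrow> ('a, 'n) form) \<Rightarrow>
   ('a, 'n) gsection \<Rightarrow> ('a, 'n) gsection" where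
  "matrix_endo H \<sigma> \<tau> K u =
     (vf_add (H (fst u)) (\<sigma> (snd u)), form_add (\<tau> (fst u)) (K (snd u)))"

definition J_flat ::
  "('a, 'n::finite) manifold \<Rightarrow> real \<Rightarrow> (('a, 'n) vfield \<Rightarrow> ('a, 'n) vfield) \<Rightarrow> ('a, 'n) tensor2 \<Rightarrow>
   ('a, 'n) gsection \<Rightarrow> ('a, 'n) gsection" where
  "J_flat M \<epsilon> J g =
     matrix_endo J (\<lambda>\<xi> p. tzero) (flat M g) (\<lambda>\<xi>. form_scale (\<lambda>p. \<epsilon>) (dual_endo M J \<xi>))"

definition J_sharp ::
  "('a, 'n::finite) manifold \<Rightarrow> real \<Rightarrow> (('a, 'n) vfield \<Rightarrow> ('a, 'n) vfield) \<Rightarrow> ('a, 'n) tensor2 \<Rightarrow>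
   ('a, 'n) gsection \<Rightarrow> ('a, 'n) gsection" where
  "J_sharp M \<epsilon> J g =
     matrix_endo J (sharp M g) (\<lambda>X p v. 0) (\<lambda>\<xi>. form_scale (\<lambda>p. \<epsilon>) (dual_endo M J \<xi>))"

end

theory Submission
  imports Defs
begin

text \<open>
  For all vector fields and 1-forms,
  \<open>G\<^sub>0(\<J>\<^sub>\<flat> (X + \<xi>), \<J>\<^sub>\<flat> (Y + \<eta>)) = (1 - \<epsilon>)/2 g(X, JY) - \<epsilon> G\<^sub>0(X + \<xi>, Y + \<eta>)\<close>, and similarly
  for \<open>\<J>\<^sub>\<sharp>\<close> with \<open>\<sharp>\<xi>, \<sharp>\<eta>\<close> in place of \<open>X, Y\<close>. This gives the Norden property for
  \<open>\<epsilon> = 1\<close>, while for \<open>\<epsilon> = -1\<close> sections with \<open>\<xi> = \<eta> = 0\<close> (respectively \<open>X = Y = 0\<close>)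
  would force \<open>g(\<cdot>, J\<cdot>) = 0\<close>, contradicting nondegeneracy.

  The analytic content is that the objects exist. Bump functions extend tangent vectors to global
  fields and show that \<open>J\<close>, given on global fields only, acts pointwise; hence \<open>J\<^sup>*\<xi>\<close> is a 1-form.
  Cramer's rule shows that \<open>\<sharp>\<xi>\<close> is smooth.
\<close>

section \<open>Calculus of smooth functions\<close>

text \<open>Everything turns on the sign in \<open>g(JX, Y) = - \<epsilon> g(X, JY)\<close>, which
  is the metric condition combined with \<open>J\<^sup>2 = -1\<close>. Evaluating \<open>G0\<close>
  on two images produces both \<open>g(X, JY)\<close> and \<open>g(Y, JX)\<close> (for
  \<open>J_sharp\<close>, with raised forms in place of the fields). For \<epsilon> = 1 the
  expression \<open>g(X, JY)\<close> is skew and the two cancel; for \<epsilon> = -1 it is symmetric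
  and they add up. The sign \<delta> in \<open>compatible\<close> offers no escape, because the
  sections that yield the contradiction lie in one summand of the bundle, on which \<open>G0\<close>
  vanishes identically. Being almost complex, by contrast, is independent of \<epsilon>: the
  off-diagonal block of the square is 0 for either sign. The form of the definitions is the main
  obstacle: \<open>dual_endo\<close> is a definite description and \<open>sharp\<close> an inverse
  on a set, so neither can be computed with before existence and uniqueness, or bijectivity of
  \<open>flat\<close>, are established.\<close>

lemma Ck_on_SucD:
  assumes "Ck_on (Suc k) S f"
  shows "x \<in> S \<Longrightarrow> (f has_derivative frechet_derivative f (at x)) (at x)"
    and "Ck_on k S (\<lambda>x. frechet_derivative f (at x) v)"
  using assms by (auto simp: frechet_derivative_works)

text \<open>A derivative at a point of an open set depends on nearby values only, so agreement on
  \<open>S\<close> passes from two functions to their derivatives and the induction can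
  continue.\<close>

lemma Ck_on_cong:
  assumes "open S" "\<And>x. x \<in> S \<Longrightarrow> f x = g x" "Ck_on k S f"
  shows "Ck_on k S g"
  using assms(2,3)
proof (induction k arbitrary: f g)
  case 0
  then show ?case
    using continuous_on_cong by (metis Ck_on.simps(1))
next
  case (Suc k)
  have deriv: "(g has_derivative frechet_derivative f (at x)) (at x)" if "x \<in> S" for x
    using has_derivative_transform_within_open[OF Ck_on_SucD(1)[OF Suc.prems(2) that] assms(1) that]
      Suc.prems(1) by auto
  have "Ck_on k S (\<lambda>x. frechet_derivative g (at x) v)" for v
    using frechet_derivative_at[OF deriv]
    by (intro Suc.IH[OF _ Ck_on_SucD(2)[OF Suc.prems(2), of v]]) auto
  then show ?case
    using deriv by (auto simp: differentiable_def)
qed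

text \<open>Since derivatives are unique, any explicit family of derivatives may replace
  \<open>frechet_derivative\<close>. The closure properties below are obtained by writing down the
  derivative and recognizing terms of lower order in it.\<close>

lemma Ck_on_SucI:
  assumes "open S"
    and "\<And>x. x \<in> S \<Longrightarrow> (f has_derivative f' x) (at x)"
    and "\<And>v. Ck_on k S (\<lambda>x. f' x v)"
  shows "Ck_on (Suc k) S f"
proof -
  have "Ck_on k S (\<lambda>x. frechet_derivative f (at x) v)" for v
    using frechet_derivative_at[OF assms(2)]
    by (intro Ck_on_cong[OF assms(1) _ assms(3)[of v]]) auto
  then show ?thesis
    using assms(2) by (auto simp: differentiable_def)
qed

lemma Ck_on_subset: "Ck_on k S f \<Longrightarrow> T \<subseteq> S \<Longrightarrow> Ck_on k T f"
  by (induction k arbitrary: f) (auto intro: continuous_on_subset)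

text \<open>Differentiability and \<open>frechet_derivative\<close> at a point involve no choice, so
  nothing has to be glued; the neighbourhoods are passed on unchanged to the derivatives.\<close>

lemma Ck_on_local:
  assumes "\<And>x. x \<in> S \<Longrightarrow> \<exists>T. open T \<and> x \<in> T \<and> Ck_on k T f"
  shows "Ck_on k S f"
  using assms
proof (induction k arbitrary: f)
  case 0
  have "isCont f x" if "x \<in> S" for x
    using 0[OF that] by (auto simp: continuous_on_eq_continuous_at)
  then show ?case
    by (simp add: continuous_at_imp_continuous_on)
next
  case (Suc k)
  have "Ck_on k S (\<lambda>x. frechet_derivative f (at x) v)" for v
    by (rule Suc.IH) (use Suc.prems in fastforce)
  moreover have "f differentiable at x" if "x \<in> S" for x
    using Suc.prems[OF that] by auto
  ultimately show ?case by simp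
qed

lemma Ck_on_Suc_imp: "Ck_on (Suc k) S f \<Longrightarrow> Ck_on k S f"
proof (induction k arbitrary: f)
  case 0
  then show ?case
    by (simp add: continuous_at_imp_continuous_on differentiable_imp_continuous_within)
next
  case (Suc k)
  then show ?case by (metis Ck_on.simps(2))
qed

lemma Ck_on_const: "open S \<Longrightarrow> Ck_on k S (\<lambda>x. a)"
proof (induction k arbitrary: a)
  case (Suc k)
  then show ?case by (intro Ck_on_SucI[where f' = "\<lambda>x v. 0"]) auto
qed auto

lemma Ck_on_linear:
  assumes "open S" "bounded_linear L" "Ck_on k S f"
  shows "Ck_on k S (\<lambda>x. L (f x))"
  using assms(3)
proof (induction k arbitrary: f)
  case 0
  then show ?case
    using assms(2) by (auto intro: bounded_linear.continuous_on)
next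
  case (Suc k)
  show ?case
    by (rule Ck_on_SucI[where f' = "\<lambda>x v. L (frechet_derivative f (at x) v)"])
      (use assms Suc Ck_on_SucD(1)[OF Suc.prems] in \<open>auto intro: bounded_linear.has_derivative\<close>)
qed

lemma Ck_on_id: "open S \<Longrightarrow> Ck_on k S (\<lambda>x. x)"
  by (cases k) (auto intro!: Ck_on_SucI[where f' = "\<lambda>x v. v"] Ck_on_const)

lemma Ck_on_add:
  assumes "open S" "Ck_on k S f" "Ck_on k S g"
  shows "Ck_on k S (\<lambda>x. f x + g x)"
  using assms(2,3)
proof (induction k arbitrary: f g)
  case 0
  then show ?case by (auto intro: continuous_on_add)
next
  case (Suc k)
  show ?case
    by (rule Ck_on_SucI[where f' = "\<lambda>x v. frechet_derivative f (at x) v + frechet_derivative g (at x) v"])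
      (use assms(1) Suc Ck_on_SucD(1)[OF Suc.prems(1)] Ck_on_SucD(1)[OF Suc.prems(2)]
        in \<open>auto intro: has_derivative_add\<close>)
qed

text \<open>Both terms of the product rule again have the form \<open>B (f x) (g x)\<close>, hence
  the induction over arbitrary pairs. Multiplication, scaling and the inner product are all
  instances.\<close>

lemma Ck_on_bilinear:
  assumes "open S" "bounded_bilinear B" "Ck_on k S f" "Ck_on k S g"
  shows "Ck_on k S (\<lambda>x. B (f x) (g x))"
  using assms(3,4)
proof (induction k arbitrary: f g)
  case 0
  then show ?case
    using assms(2) by (auto intro: bounded_bilinear.continuous_on)
next
  case (Suc k)
  show ?case
  proof (rule Ck_on_SucI[where f' = "\<lambda>x v. B (f x) (frechet_derivative g (at x) v) +
      B (frechet_derivative f (at x) v) (g x)"])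
    show "((\<lambda>x. B (f x) (g x)) has_derivative
        (\<lambda>v. B (f x) (frechet_derivative g (at x) v) + B (frechet_derivative f (at x) v) (g x))) (at x)"
      if "x \<in> S" for x
      by (rule bounded_bilinear.FDERIV[OF assms(2)]) (use Ck_on_SucD(1)[OF _ that] Suc.prems in auto)
    show "Ck_on k S (\<lambda>x. B (f x) (frechet_derivative g (at x) v) +
        B (frechet_derivative f (at x) v) (g x))" for v
      using Suc.prems[THEN Ck_on_Suc_imp] Suc.prems[THEN Ck_on_SucD(2)]
      by (intro Ck_on_add Suc.IH assms(1))
  qed (rule assms)
qed

text \<open>The derivative contains only \<open>inverse (f x)\<close> itself and a derivative of
  \<open>f\<close>, so the induction hypothesis for the same \<open>f\<close> suffices.\<close>

lemma Ck_on_inverse: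
  fixes f :: "'a::euclidean_space \<Rightarrow> real"
  assumes "open S" "Ck_on k S f" "\<And>x. x \<in> S \<Longrightarrow> f x \<noteq> 0"
  shows "Ck_on k S (\<lambda>x. inverse (f x))"
  using assms(2)
proof (induction k)
  case 0
  then show ?case using assms by (auto intro: continuous_on_inverse)
next
  case (Suc k)
  show ?case
  proof (rule Ck_on_SucI[where f' = "\<lambda>x v. - (inverse (f x) * frechet_derivative f (at x) v * inverse (f x))"])
    show "((\<lambda>x. inverse (f x)) has_derivative
        (\<lambda>v. - (inverse (f x) * frechet_derivative f (at x) v * inverse (f x)))) (at x)" if "x \<in> S" for x
      by (rule Deriv.has_derivative_inverse) (use Ck_on_SucD(1)[OF Suc.prems that] assms(3) that in auto)
    show "Ck_on k S (\<lambda>x. - (inverse (f x) * frechet_derivative f (at x) v * inverse (f x)))" for v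
      by (intro Ck_on_linear[OF assms(1) bounded_linear_minus[OF bounded_linear_ident]]
          Ck_on_bilinear[OF assms(1) bounded_bilinear_mult] Suc.IH
          Ck_on_Suc_imp[OF Suc.prems] Ck_on_SucD(2)[OF Suc.prems])
  qed (rule assms)
qed

lemma Ck_on_sum:
  assumes "open S" "\<And>i. i \<in> I \<Longrightarrow> Ck_on k S (f i)"
  shows "Ck_on k S (\<lambda>x. \<Sum>i\<in>I. f i x)"
  using assms(2) by (induction I rule: infinite_finite_induct)
    (auto intro: Ck_on_const Ck_on_add assms(1))

lemma Ck_on_compose:
  fixes g :: "'a::euclidean_space \<Rightarrow> 'b::euclidean_space"
  assumes "open S" "open T" "Ck_on k S g" "Ck_on k T f" "g ` S \<subseteq> T"
  shows "Ck_on k S (\<lambda>x. f (g x))"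
  using assms(3,4)
proof (induction k arbitrary: f)
  case 0
  then show ?case using assms(5) by (auto intro: continuous_on_compose2)
next
  case (Suc k)
  \<comment> \<open>The chain rule applies the derivative of \<open>f\<close> to a direction that
    moves with \<open>x\<close>, but \<open>Ck_on\<close> controls fixed directions only. Expanding
    in \<open>Basis\<close> moves this dependence into scalar coefficients.\<close>
  let ?f' = "\<lambda>x v. \<Sum>b\<in>Basis. (frechet_derivative g (at x) v \<bullet> b) *\<^sub>R frechet_derivative f (at (g x)) b"
  show ?case
  proof (rule Ck_on_SucI[where f' = ?f'])
    fix x assume x: "x \<in> S"
    then have "g x \<in> T" using assms(5) by auto
    note f' = Ck_on_SucD(1)[OF Suc.prems(2) this] and g' = Ck_on_SucD(1)[OF Suc.prems(1) x]
    have lin: "linear (frechet_derivative f (at (g x)))"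
      using f' has_derivative_linear by blast
    have "frechet_derivative f (at (g x)) w =
        (\<Sum>b\<in>Basis. (w \<bullet> b) *\<^sub>R frechet_derivative f (at (g x)) b)" for w
      by (subst euclidean_representation[of w, symmetric])
        (simp add: linear_sum[OF lin] linear_cmul[OF lin])
    then have "(\<lambda>v. frechet_derivative f (at (g x)) (frechet_derivative g (at x) v)) = ?f' x"
      by blast
    then show "((\<lambda>x. f (g x)) has_derivative ?f' x) (at x)"
      using has_derivative_compose[OF g' f'] by (simp only:)
  next
    fix v
    have "Ck_on k S (\<lambda>x. frechet_derivative f (at (g x)) b)" for b
      by (rule Suc.IH[OF Ck_on_Suc_imp[OF Suc.prems(1)] Ck_on_SucD(2)[OF Suc.prems(2)]])
    then show "Ck_on k S (\<lambda>x. ?f' x v)"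
      by (intro Ck_on_sum assms(1) Ck_on_bilinear[OF assms(1) bounded_bilinear_scaleR]
          Ck_on_linear[OF assms(1) bounded_linear_inner_left]
          Ck_on_SucD(2)[OF Suc.prems(1)])
  qed (rule assms)
qed

lemma smooth_on_cong: "open S \<Longrightarrow> smooth_on S f \<Longrightarrow> (\<And>x. x \<in> S \<Longrightarrow> f x = g x) \<Longrightarrow> smooth_on S g"
  by (auto simp: smooth_on_def intro: Ck_on_cong[where f = f])

lemma smooth_on_subset: "smooth_on S f \<Longrightarrow> T \<subseteq> S \<Longrightarrow> smooth_on T f"
  unfolding smooth_on_def by (meson Ck_on_subset)

lemma smooth_on_local:
  assumes "\<And>x. x \<in> S \<Longrightarrow> \<exists>T. open T \<and> x \<in> T \<and> smooth_on T f"
  shows "smooth_on S f"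
  unfolding smooth_on_def
proof
  show "Ck_on k S f" for k
    by (rule Ck_on_local) (use assms in \<open>force simp: smooth_on_def\<close>)
qed

lemma smooth_on_const: "open S \<Longrightarrow> smooth_on S (\<lambda>x. a)"
  by (simp add: smooth_on_def Ck_on_const)

lemma smooth_on_id: "open S \<Longrightarrow> smooth_on S (\<lambda>x. x)"
  by (simp add: smooth_on_def Ck_on_id)

lemma smooth_on_linear:
  "open S \<Longrightarrow> bounded_linear L \<Longrightarrow> smooth_on S f \<Longrightarrow> smooth_on S (\<lambda>x. L (f x))"
  by (simp add: smooth_on_def Ck_on_linear)

lemma smooth_on_add:
  "open S \<Longrightarrow> smooth_on S f \<Longrightarrow> smooth_on S g \<Longrightarrow> smooth_on S (\<lambda>x. f x + g x)"
  by (simp add: smooth_on_def Ck_on_add)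

lemma smooth_on_sum:
  "open S \<Longrightarrow> (\<And>i. i \<in> I \<Longrightarrow> smooth_on S (f i)) \<Longrightarrow> smooth_on S (\<lambda>x. \<Sum>i\<in>I. f i x)"
  by (simp add: smooth_on_def Ck_on_sum)

lemma smooth_on_bilinear:
  "open S \<Longrightarrow> bounded_bilinear B \<Longrightarrow> smooth_on S f \<Longrightarrow> smooth_on S g \<Longrightarrow>
    smooth_on S (\<lambda>x. B (f x) (g x))"
  by (simp add: smooth_on_def Ck_on_bilinear)

lemma smooth_on_scaleR:
  "open S \<Longrightarrow> smooth_on S f \<Longrightarrow> smooth_on S g \<Longrightarrow> smooth_on S (\<lambda>x. f x *\<^sub>R g x)"
  by (rule smooth_on_bilinear[OF _ bounded_bilinear_scaleR])

lemma smooth_on_mult: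
  fixes f g :: "'a::euclidean_space \<Rightarrow> real"
  shows "open S \<Longrightarrow> smooth_on S f \<Longrightarrow> smooth_on S g \<Longrightarrow> smooth_on S (\<lambda>x. f x * g x)"
  by (rule smooth_on_bilinear[OF _ bounded_bilinear_mult])

lemma smooth_on_prod:
  fixes f :: "'i \<Rightarrow> 'a::euclidean_space \<Rightarrow> real"
  assumes "open S" "\<And>i. i \<in> I \<Longrightarrow> smooth_on S (f i)"
  shows "smooth_on S (\<lambda>x. \<Prod>i\<in>I. f i x)"
  using assms(2) by (induction I rule: infinite_finite_induct)
    (auto intro: smooth_on_const smooth_on_mult assms(1))

lemma smooth_on_divide:
  fixes f g :: "'a::euclidean_space \<Rightarrow> real"
  assumes "open S" "smooth_on S f" "smooth_on S g" "\<And>x. x \<in> S \<Longrightarrow> g x \<noteq> 0"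
  shows "smooth_on S (\<lambda>x. f x / g x)"
  using assms by (auto simp: divide_inverse smooth_on_def intro!: Ck_on_inverse
      Ck_on_bilinear[OF _ bounded_bilinear_mult])

lemma smooth_on_compose:
  fixes g :: "'a::euclidean_space \<Rightarrow> 'b::euclidean_space"
  shows "open S \<Longrightarrow> open T \<Longrightarrow> smooth_on S g \<Longrightarrow> smooth_on T f \<Longrightarrow> g ` S \<subseteq> T \<Longrightarrow>
    smooth_on S (\<lambda>x. f (g x))"
  unfolding smooth_on_def using Ck_on_compose by blast

lemma smooth_on_has_derivative:
  assumes "smooth_on S f" "x \<in> S"
  shows "(f has_derivative frechet_derivative f (at x)) (at x)"
  using Ck_on_SucD(1)[of 0 S f x] assms unfolding smooth_on_def by blast

lemma smooth_on_frechet_derivative: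
  "smooth_on S f \<Longrightarrow> smooth_on S (\<lambda>x. frechet_derivative f (at x) v)"
  unfolding smooth_on_def using Ck_on_SucD(2) by blast

lemma smooth_on_vec_iff:
  fixes f :: "'a::euclidean_space \<Rightarrow> real ^ 'n"
  assumes "open S"
  shows "smooth_on S f \<longleftrightarrow> (\<forall>i. smooth_on S (\<lambda>x. f x $ i))"
proof
  assume "smooth_on S f"
  then show "\<forall>i. smooth_on S (\<lambda>x. f x $ i)"
    by (auto intro: smooth_on_linear[OF assms bounded_linear_vec_nth])
next
  assume "\<forall>i. smooth_on S (\<lambda>x. f x $ i)"
  then have "smooth_on S (\<lambda>x. \<Sum>i\<in>UNIV. f x $ i *\<^sub>R axis i (1::real))"
    using assms by (intro smooth_on_sum smooth_on_scaleR smooth_on_const) auto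
  moreover have "(\<Sum>i\<in>UNIV. f x $ i *\<^sub>R axis i (1::real)) = f x" for x
    using basis_expansion[of "f x"] by (simp add: scalar_mult_eq_scaleR)
  ultimately show "smooth_on S f" by (simp only:)
qed

lemma smooth_on_det:
  fixes A :: "'a::euclidean_space \<Rightarrow> real ^ 'n ^ 'n"
  assumes "open S" "\<And>i j. smooth_on S (\<lambda>x. A x $ i $ j)"
  shows "smooth_on S (\<lambda>x. det (A x))"
  unfolding det_def
  using assms by (intro smooth_on_sum smooth_on_mult smooth_on_const smooth_on_prod)

section \<open>Smooth bump functions\<close>

text \<open>The powers of \<open>1/t\<close> make this family closed under differentiation.\<close>

definition flat_exp :: "nat \<Rightarrow> real \<Rightarrow> real" where
  "flat_exp k t = (if t > 0 then exp (- inverse t) * inverse t ^ k else 0)"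

text \<open>Substituting \<open>s = 1/t\<close> turns the right-hand limit into that of
  \<open>s ^ k / exp s\<close> at infinity; on the left the function is 0.\<close>

lemma flat_exp_tendsto_0: "(flat_exp k \<longlongrightarrow> 0) (at 0)"
proof -
  have "((\<lambda>t::real. t ^ k / exp t) \<longlongrightarrow> 0) at_top"
    by (rule tendsto_power_div_exp_0)
  then have "((\<lambda>t::real. inverse t ^ k / exp (inverse t)) \<longlongrightarrow> 0) (at_right 0)"
    by (rule filterlim_compose) (rule filterlim_inverse_at_top_right)
  moreover have "\<forall>\<^sub>F t in at_right 0. inverse t ^ k / exp (inverse t) = flat_exp k t"
    by (auto simp: eventually_at_right_less flat_exp_def exp_minus divide_inverse
        intro!: eventually_mono[OF eventually_at_right_less[of 0]])
  ultimately have "(flat_exp k \<longlongrightarrow> 0) (at_right 0)"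
    by (rule Lim_transform_eventually)
  moreover have "(flat_exp k \<longlongrightarrow> 0) (at_left 0)"
    by (rule Lim_transform_eventually[OF tendsto_const])
      (auto simp: flat_exp_def eventually_at_filter)
  ultimately show ?thesis
    by (simp add: filterlim_at_split)
qed

lemma flat_exp_has_derivative:
  "(flat_exp k has_real_derivative flat_exp (k + 2) t - k * flat_exp (k + 1) t) (at t)"
proof (cases t "0::real" rule: linorder_cases)
  case less
  have "((\<lambda>t. 0) has_real_derivative 0) (at t)" by simp
  then have "(flat_exp k has_real_derivative 0) (at t)"
    by (rule has_field_derivative_transform_within_open[where S = "{..<0}"])
      (use less in \<open>auto simp: flat_exp_def\<close>)
  then show ?thesis using less by (simp add: flat_exp_def)
next
  case equal
  \<comment> \<open>At 0 the difference quotient is the next member \<open>flat_exp (Suc k)\<close>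
    of the family, whose limit is 0.\<close>
  have "((\<lambda>h. (flat_exp k (0 + h) - flat_exp k 0) / h) \<longlongrightarrow> 0) (at 0)"
    by (rule Lim_transform_eventually[OF flat_exp_tendsto_0[of "Suc k"]])
      (auto simp: flat_exp_def field_simps eventually_at_filter)
  then show ?thesis using equal by (simp add: DERIV_def flat_exp_def)
next
  case greater
  \<comment> \<open>The exponent \<open>k - 1\<close> is truncated at \<open>k = 0\<close>, where
    the factor \<open>k\<close> makes both sides vanish.\<close>
  have pow: "k * inverse t ^ (k - 1) * inverse t = k * inverse t ^ k"
    by (cases k) auto
  have "((\<lambda>t. exp (- inverse t) * inverse t ^ k) has_real_derivative
      exp (- inverse t) * (inverse t)\<^sup>2 * inverse t ^ k
      + exp (- inverse t) * (k * inverse t ^ (k - 1) * - (inverse t)\<^sup>2)) (at t)"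
    using greater by (auto intro!: derivative_eq_intros simp: power2_eq_square)
  also have "exp (- inverse t) * (inverse t)\<^sup>2 * inverse t ^ k
      + exp (- inverse t) * (k * inverse t ^ (k - 1) * - (inverse t)\<^sup>2)
      = exp (- inverse t) * inverse t ^ (k + 2)
      - exp (- inverse t) * inverse t * (k * inverse t ^ (k - 1) * inverse t)"
    by (simp add: power_add power2_eq_square)
  also have "\<dots> = flat_exp (k + 2) t - k * flat_exp (k + 1) t"
    unfolding pow using greater by (simp add: flat_exp_def)
  finally have "((\<lambda>t. exp (- inverse t) * inverse t ^ k) has_real_derivative
      flat_exp (k + 2) t - k * flat_exp (k + 1) t) (at t)" .
  then show ?thesis
    by (rule has_field_derivative_transform_within_open[where S = "{0<..}"])
      (use greater in \<open>auto simp: flat_exp_def\<close>)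
qed

text \<open>The induction is on the order of differentiability with \<open>k\<close> arbitrary,
  because the derivative of one member involves the members \<open>k + 1\<close> and
  \<open>k + 2\<close>.\<close>

lemma smooth_on_flat_exp: "smooth_on UNIV (flat_exp k)"
proof -
  have "Ck_on m UNIV (flat_exp k)" for m
  proof (induction m arbitrary: k)
    case 0
    then show ?case
      using DERIV_isCont[OF flat_exp_has_derivative] by (simp add: continuous_at_imp_continuous_on)
  next
    case (Suc m)
    show ?case
    proof (rule Ck_on_SucI[where f' = "\<lambda>t v. (flat_exp (k + 2) t + - real k * flat_exp (k + 1) t) * v"])
      show "(flat_exp k has_derivative (\<lambda>v. (flat_exp (k + 2) t + - real k * flat_exp (k + 1) t) * v)) (at t)"
        for t using flat_exp_has_derivative[of k t] by (simp add: has_field_derivative_def)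
      show "Ck_on m UNIV (\<lambda>t. (flat_exp (k + 2) t + - real k * flat_exp (k + 1) t) * v)" for v
        by (intro Ck_on_bilinear[OF open_UNIV bounded_bilinear_mult] Ck_on_add Ck_on_const
            Suc.IH open_UNIV)
    qed (rule open_UNIV)
  qed
  then show ?thesis by (simp add: smooth_on_def)
qed

text \<open>This is \<open>exp (-1/s)\<close> at \<open>s = r\<^sup>2 - |x - a|\<^sup>2\<close>; the
  squared distance is a polynomial and so is smooth at the centre too. There is no plateau of value
  1: later arguments divide by a nonzero value instead.\<close>

definition bump :: "'a::euclidean_space \<Rightarrow> real \<Rightarrow> 'a \<Rightarrow> real" where
  "bump a r x = flat_exp 0 (r\<^sup>2 - (x - a) \<bullet> (x - a))"

lemma smooth_on_bump: "smooth_on UNIV (bump a r)"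
proof -
  have diff: "smooth_on UNIV (\<lambda>x. x + - a)"
    by (intro smooth_on_add smooth_on_id smooth_on_const) auto
  have "smooth_on UNIV (\<lambda>x. (x + - a) \<bullet> (x + - a))"
    by (rule smooth_on_bilinear[OF open_UNIV bounded_bilinear_inner diff diff])
  then have "smooth_on UNIV (\<lambda>x. r\<^sup>2 + - ((x + - a) \<bullet> (x + - a)))"
    by (intro smooth_on_add smooth_on_const open_UNIV
        smooth_on_linear[OF open_UNIV bounded_linear_minus[OF bounded_linear_ident]])
  from smooth_on_compose[OF open_UNIV open_UNIV this smooth_on_flat_exp[of 0]]
  show ?thesis by (simp add: bump_def[abs_def])
qed

lemma bump_nonzero_iff:
  assumes "r > 0"
  shows "bump a r x \<noteq> 0 \<longleftrightarrow> x \<in> ball a r"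
proof -
  have "bump a r x \<noteq> 0 \<longleftrightarrow> (norm (x - a))\<^sup>2 < r\<^sup>2"
    by (simp add: bump_def flat_exp_def power2_norm_eq_inner)
  also have "\<dots> \<longleftrightarrow> norm (x - a) < r"
    using assms power_mono_iff[of r "norm (x - a)" 2] by (auto simp: not_le[symmetric])
  finally show ?thesis
    by (simp add: dist_norm norm_minus_commute)
qed

section \<open>Charts, tangent vectors and cut-offs\<close>

locale smooth_mfd =
  fixes M :: "('a, 'n::finite) manifold"
  assumes smooth_M: "smooth_manifold M"
begin

lemma is_chart: "c \<in> atlas M \<Longrightarrow> is_chart (mtop M) c"
  using smooth_M by (simp add: smooth_manifold_def)

lemma open_chart_image: "c \<in> atlas M \<Longrightarrow> open (chart_image c)"
  using is_chart by (auto simp: is_chart_def)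

lemma openin_chart: "c \<in> atlas M \<Longrightarrow> openin (mtop M) (fst c)"
  using is_chart by (auto simp: is_chart_def)

lemma chart_subset: "c \<in> atlas M \<Longrightarrow> fst c \<subseteq> points M"
  using openin_chart openin_subset points_def by metis

lemma chart_homeo:
  "c \<in> atlas M \<Longrightarrow> homeomorphic_map (subtopology (mtop M) (fst c)) (top_of_set (chart_image c)) (snd c)"
  using is_chart by (auto simp: is_chart_def)

lemma inj_on_chart: "c \<in> atlas M \<Longrightarrow> inj_on (snd c) (fst c)"
  using homeomorphic_imp_injective_map[OF chart_homeo] chart_subset
  by (simp add: points_def Int_absorb1)

lemma chart_inv_chart [simp]: "c \<in> atlas M \<Longrightarrow> p \<in> fst c \<Longrightarrow> chart_inv c (snd c p) = p"
  by (simp add: chart_inv_def inj_on_chart)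

lemma chart_in_image [simp]: "p \<in> fst c \<Longrightarrow> snd c p \<in> chart_image c"
  by (simp add: chart_image_def)

lemma chart_inv_in [simp]: "x \<in> chart_image c \<Longrightarrow> chart_inv c x \<in> fst c"
  by (simp add: chart_image_def chart_inv_def inv_into_into)

lemma chart_inv_in_points: "c \<in> atlas M \<Longrightarrow> x \<in> chart_image c \<Longrightarrow> chart_inv c x \<in> points M"
  using chart_inv_in chart_subset by blast

lemma chart_chart_inv [simp]: "x \<in> chart_image c \<Longrightarrow> snd c (chart_inv c x) = x"
  by (simp add: chart_image_def chart_inv_def f_inv_into_f)

lemma chart_at_point:
  assumes "p \<in> points M"
  obtains c where "c \<in> atlas M" "p \<in> fst c"
proof -
  have "(\<Union>c\<in>atlas M. fst c) = points M"
    using smooth_M by (simp add: smooth_manifold_def)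
  then show ?thesis using assms that by blast
qed

lemma open_chart_Int:
  assumes c: "c \<in> atlas M" and W: "openin (mtop M) W"
  shows "open (snd c ` (fst c \<inter> W))"
proof -
  have "openin (subtopology (mtop M) (fst c)) (fst c \<inter> W)"
    using W by (auto simp: openin_subtopology)
  then have "openin (top_of_set (chart_image c)) (snd c ` (fst c \<inter> W))"
    using homeomorphic_imp_open_map[OF chart_homeo[OF c]] by (auto simp: open_map_def)
  then show ?thesis
    using open_chart_image[OF c] openin_open_trans by blast
qed

text \<open>Compactness is carried back through the chart, and in the Hausdorff space
  \<open>mtop M\<close> compact sets are closed. A set that is closed in the chart domain need not
  be closed in \<open>M\<close>, and closedness in \<open>M\<close> is what extension by zero
  requires.\<close>

lemma closedin_chart_preimage:
  assumes c: "c \<in> atlas M" and K: "compact K" "K \<subseteq> chart_image c"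
  shows "closedin (mtop M) {q \<in> fst c. snd c q \<in> K}"
proof -
  let ?K = "{q \<in> fst c. snd c q \<in> K}"
  have "snd c ` ?K = K"
    using K(2) by (auto simp: chart_image_def)
  then have "compactin (top_of_set (chart_image c)) (snd c ` ?K)"
    using K by (simp add: compactin_subtopology)
  moreover have "?K \<subseteq> topspace (subtopology (mtop M) (fst c))"
    using chart_subset[OF c] by (auto simp: points_def)
  ultimately have "compactin (subtopology (mtop M) (fst c)) ?K"
    using homeomorphic_map_compactness[OF chart_homeo[OF c]] by blast
  then have "compactin (mtop M) ?K"
    by (simp add: compactin_subtopology)
  moreover have "Hausdorff_space (mtop M)"
    using smooth_M by (simp add: smooth_manifold_def)
  ultimately show ?thesis
    by (simp add: compactin_imp_closedin)
qed

abbreviation overlap where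
  "overlap c d \<equiv> snd c ` (fst c \<inter> fst d)"

lemma open_overlap: "c \<in> atlas M \<Longrightarrow> d \<in> atlas M \<Longrightarrow> open (overlap c d)"
  by (simp add: open_chart_Int openin_chart)

lemma overlap_subset: "overlap c d \<subseteq> chart_image c"
  by (auto simp: chart_image_def)

lemma smooth_transition:
  "c \<in> atlas M \<Longrightarrow> d \<in> atlas M \<Longrightarrow> smooth_on (overlap c d) (\<lambda>x. snd d (chart_inv c x))"
  using smooth_M by (auto simp: smooth_manifold_def comp_def)

lemma transition_has_derivative:
  assumes "c \<in> charts_at M p" "d \<in> charts_at M p"
  shows "((\<lambda>x. snd d (chart_inv c x)) has_derivative transition_deriv c d p) (at (snd c p))"
  using smooth_on_has_derivative[OF smooth_transition[of c d], of "snd c p"] assms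
  by (auto simp: transition_deriv_def charts_at_def comp_def)

lemma linear_transition_deriv:
  "c \<in> charts_at M p \<Longrightarrow> d \<in> charts_at M p \<Longrightarrow> linear (transition_deriv c d p)"
  using transition_has_derivative has_derivative_linear by blast

lemma transition_deriv_self:
  assumes c: "c \<in> charts_at M p"
  shows "transition_deriv c c p = (\<lambda>w. w)"
proof -
  have c': "c \<in> atlas M" "p \<in> fst c" using c by (auto simp: charts_at_def)
  have "((\<lambda>x. x) has_derivative (\<lambda>w. w)) (at (snd c p))" by simp
  then have "((\<lambda>x. snd c (chart_inv c x)) has_derivative (\<lambda>w. w)) (at (snd c p))"
    by (rule has_derivative_transform_within_open[OF _ open_chart_image[OF c'(1)]]) (use c' in auto)
  then show ?thesis
    using transition_has_derivative[OF c c] has_derivative_unique by blast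
qed

text \<open>The cocycle rule is the chain rule: on the open set \<open>overlap c d\<close> passing
  through \<open>d\<close> and back changes nothing. It makes the components in
  \<open>coord_vec\<close> consistent with each other.\<close>

lemma transition_deriv_trans:
  assumes cde: "c \<in> charts_at M p" "d \<in> charts_at M p" "e \<in> charts_at M p"
  shows "transition_deriv d e p (transition_deriv c d p w) = transition_deriv c e p w"
proof -
  have A: "c \<in> atlas M" "d \<in> atlas M" "e \<in> atlas M" "p \<in> fst c" "p \<in> fst d" "p \<in> fst e"
    using cde by (auto simp: charts_at_def)
  have "((\<lambda>x. snd e (chart_inv d x)) has_derivative transition_deriv d e p)
      (at (snd d (chart_inv c (snd c p))))"
    using transition_has_derivative[OF cde(2,3)] A by simp
  from has_derivative_compose[OF transition_has_derivative[OF cde(1,2)] this]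
  have "((\<lambda>x. snd e (chart_inv d (snd d (chart_inv c x)))) has_derivative
      (\<lambda>w. transition_deriv d e p (transition_deriv c d p w))) (at (snd c p))" .
  then have "((\<lambda>x. snd e (chart_inv c x)) has_derivative
      (\<lambda>w. transition_deriv d e p (transition_deriv c d p w))) (at (snd c p))"
    by (rule has_derivative_transform_within_open[OF _ open_overlap[OF A(1,2)]]) (use A in auto)
  then show ?thesis
    using transition_has_derivative[OF cde(1,3)] has_derivative_unique by (metis (no_types, lifting))
qed

lemma smooth_transition_deriv:
  assumes "c \<in> atlas M" "d \<in> atlas M"
  shows "smooth_on (overlap c d) (\<lambda>x. transition_deriv c d (chart_inv c x) w)"
proof (rule smooth_on_cong[OF open_overlap[OF assms]
      smooth_on_frechet_derivative[OF smooth_transition[OF assms]]])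
  fix x assume "x \<in> overlap c d"
  then show "frechet_derivative (\<lambda>x. snd d (chart_inv c x)) (at x) w =
      transition_deriv c d (chart_inv c x) w"
    using assms by (auto simp: transition_deriv_def comp_def)
qed

section \<open>Tangent and cotangent spaces\<close>

lemma tangent_space_outside:
  assumes "p \<notin> points M"
  shows "tangent_space M p = {tzero}"
proof -
  have "charts_at M p = {}"
    using assms chart_subset unfolding charts_at_def by blast
  then show ?thesis
    by (auto simp: tangent_space_def tzero_def)
qed

lemma tangent_spaceI:
  assumes "\<And>c. c \<notin> charts_at M p \<Longrightarrow> v c = 0"
    and "\<And>c d. c \<in> charts_at M p \<Longrightarrow> d \<in> charts_at M p \<Longrightarrow> transition_deriv c d p (v c) = v d"
  shows "v \<in> tangent_space M p"
  unfolding tangent_space_def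
  by (intro CollectI conjI allI ballI impI assms(1) assms(2)[symmetric])

lemma tangent_spaceD:
  assumes "v \<in> tangent_space M p"
  shows "c \<notin> charts_at M p \<Longrightarrow> v c = 0"
    and "c \<in> charts_at M p \<Longrightarrow> d \<in> charts_at M p \<Longrightarrow> transition_deriv c d p (v c) = v d"
  using assms unfolding tangent_space_def mem_Collect_eq by metis+

lemma tzero_in_tangent_space: "tzero \<in> tangent_space M p"
  by (rule tangent_spaceI) (simp_all add: tzero_def linear_0[OF linear_transition_deriv])

lemma tadd_in_tangent_space:
  "v \<in> tangent_space M p \<Longrightarrow> w \<in> tangent_space M p \<Longrightarrow> tadd v w \<in> tangent_space M p"
  by (rule tangent_spaceI) (simp_all add: tadd_def linear_add[OF linear_transition_deriv] tangent_spaceD)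

lemma tscale_in_tangent_space:
  "v \<in> tangent_space M p \<Longrightarrow> tscale r v \<in> tangent_space M p"
  by (rule tangent_spaceI) (simp_all add: tscale_def linear_cmul[OF linear_transition_deriv] tangent_spaceD)

lemma coord_vec_in_tangent_space:
  "c \<in> charts_at M p \<Longrightarrow> coord_vec M c p w \<in> tangent_space M p"
  by (rule tangent_spaceI) (simp_all add: coord_vec_def transition_deriv_trans)

lemma coord_vec_self: "c \<in> charts_at M p \<Longrightarrow> coord_vec M c p w c = w"
  by (simp add: coord_vec_def transition_deriv_self)

lemma coord_vec_of_tangent:
  "c \<in> charts_at M p \<Longrightarrow> v \<in> tangent_space M p \<Longrightarrow> coord_vec M c p (v c) = v"
  by (auto simp: coord_vec_def tangent_spaceD)

lemma tangent_eqI: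
  "c \<in> charts_at M p \<Longrightarrow> v \<in> tangent_space M p \<Longrightarrow> w \<in> tangent_space M p \<Longrightarrow> v c = w c \<Longrightarrow> v = w"
  by (metis coord_vec_of_tangent)

lemma coord_vec_add:
  "c \<in> charts_at M p \<Longrightarrow> coord_vec M c p (v + w) = tadd (coord_vec M c p v) (coord_vec M c p w)"
  by (auto simp: coord_vec_def tadd_def linear_add[OF linear_transition_deriv])

lemma coord_vec_scale:
  "c \<in> charts_at M p \<Longrightarrow> coord_vec M c p (r *\<^sub>R w) = tscale r (coord_vec M c p w)"
  by (auto simp: coord_vec_def tscale_def linear_cmul[OF linear_transition_deriv])

lemma charts_atI [simp]: "c \<in> atlas M \<Longrightarrow> p \<in> fst c \<Longrightarrow> c \<in> charts_at M p"
  by (simp add: charts_at_def)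

text \<open>\<open>tadd\<close> and \<open>tscale\<close> act on functions of charts, and linearity
  is given on a subset of these only. Composing with \<open>coord_vec M c p\<close> yields a linear
  map on all of \<open>real ^ 'n\<close>, where the standard basis can be used.\<close>

lemma linear_on_tangent_space_expand:
  assumes c: "c \<in> charts_at M p" and v: "v \<in> tangent_space M p"
    and add: "\<And>v w. v \<in> tangent_space M p \<Longrightarrow> w \<in> tangent_space M p \<Longrightarrow> a (tadd v w) = a v + a w"
    and scale: "\<And>r v. v \<in> tangent_space M p \<Longrightarrow> a (tscale r v) = r * a v"
  shows "a v = (\<Sum>i\<in>UNIV. v c $ i * a (coord_vec M c p (axis i 1)))"
proof -
  have lin: "linear (\<lambda>w. a (coord_vec M c p w))"
    by (rule linearI)
      (simp_all add: c coord_vec_add coord_vec_scale coord_vec_in_tangent_space add scale)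
  have "v c = (\<Sum>i\<in>UNIV. v c $ i *\<^sub>R axis i (1::real))"
    using basis_expansion[of "v c"] by (simp add: scalar_mult_eq_scaleR)
  then have "a (coord_vec M c p (v c)) = a (coord_vec M c p (\<Sum>i\<in>UNIV. v c $ i *\<^sub>R axis i (1::real)))"
    by simp
  also have "\<dots> = (\<Sum>i\<in>UNIV. v c $ i * a (coord_vec M c p (axis i 1)))"
    by (simp only: linear_sum[OF lin] linear_cmul[OF lin] real_scaleR_def)
  finally show ?thesis
    by (simp add: coord_vec_of_tangent[OF c v])
qed

lemma cotangent_space_expand:
  assumes "c \<in> charts_at M p" "v \<in> tangent_space M p" "a \<in> cotangent_space M p"
  shows "a v = (\<Sum>i\<in>UNIV. v c $ i * a (coord_vec M c p (axis i 1)))"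
  using assms by (intro linear_on_tangent_space_expand) (auto simp: cotangent_space_def)

lemma cotangent_eqI:
  assumes "a \<in> cotangent_space M p" "b \<in> cotangent_space M p"
    and "\<And>v. v \<in> tangent_space M p \<Longrightarrow> a v = b v"
  shows "a = b"
proof
  show "a v = b v" for v
    using assms by (cases "v \<in> tangent_space M p") (auto simp: cotangent_space_def)
qed

section \<open>Vector fields, 1-forms and smooth functions\<close>

lemma vfieldsI:
  assumes "\<And>p. X p \<in> tangent_space M p"
    and "\<And>c. c \<in> atlas M \<Longrightarrow> smooth_on (chart_image c) (\<lambda>x. X (chart_inv c x) c)"
  shows "X \<in> vfields M"
  using assms by (simp add: vfields_def)

lemma vfields_smooth:
  "X \<in> vfields M \<Longrightarrow> c \<in> atlas M \<Longrightarrow> smooth_on (chart_image c) (\<lambda>x. X (chart_inv c x) c)"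
  by (simp add: vfields_def)

lemma vfields_smooth_nth:
  "X \<in> vfields M \<Longrightarrow> c \<in> atlas M \<Longrightarrow> smooth_on (chart_image c) (\<lambda>x. X (chart_inv c x) c $ i)"
  using vfields_smooth[of X c] smooth_on_vec_iff[OF open_chart_image[of c]] by metis

lemma one_formsI:
  assumes "\<And>p v w. v \<in> tangent_space M p \<Longrightarrow> w \<in> tangent_space M p \<Longrightarrow> \<xi> p (tadd v w) = \<xi> p v + \<xi> p w"
    and "\<And>p r v. v \<in> tangent_space M p \<Longrightarrow> \<xi> p (tscale r v) = r * \<xi> p v"
    and "\<And>p v. v \<notin> tangent_space M p \<Longrightarrow> \<xi> p v = 0"
    and "\<And>c w. c \<in> atlas M \<Longrightarrow> smooth_on (chart_image c)
        (\<lambda>x. \<xi> (chart_inv c x) (coord_vec M c (chart_inv c x) w))"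
  shows "\<xi> \<in> one_forms M"
  using assms by (simp add: one_forms_def cotangent_space_def)

lemma one_forms_smooth:
  "\<xi> \<in> one_forms M \<Longrightarrow> c \<in> atlas M \<Longrightarrow>
    smooth_on (chart_image c) (\<lambda>x. \<xi> (chart_inv c x) (coord_vec M c (chart_inv c x) w))"
  by (simp add: one_forms_def)

lemma smooth_funsI:
  assumes "\<And>p. p \<notin> points M \<Longrightarrow> f p = 0"
    and "\<And>c. c \<in> atlas M \<Longrightarrow> smooth_on (chart_image c) (\<lambda>x. f (chart_inv c x))"
  shows "f \<in> smooth_funs M"
  using assms by (simp add: smooth_funs_def comp_def)

lemma smooth_funs_smooth:
  "f \<in> smooth_funs M \<Longrightarrow> c \<in> atlas M \<Longrightarrow> smooth_on (chart_image c) (\<lambda>x. f (chart_inv c x))"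
  by (simp add: smooth_funs_def comp_def)

lemma vfields_tangent: "X \<in> vfields M \<Longrightarrow> X p \<in> tangent_space M p"
  by (simp add: vfields_def)

lemma one_forms_cotangent: "\<xi> \<in> one_forms M \<Longrightarrow> \<xi> p \<in> cotangent_space M p"
  by (simp add: one_forms_def)

lemma vfields_outside: "X \<in> vfields M \<Longrightarrow> p \<notin> points M \<Longrightarrow> X p = tzero"
  using vfields_tangent tangent_space_outside by auto

lemma one_forms_tzero: "\<xi> \<in> one_forms M \<Longrightarrow> \<xi> p tzero = 0"
proof -
  assume "\<xi> \<in> one_forms M"
  then have "\<xi> p (tscale 0 tzero) = 0 * \<xi> p tzero"
    using one_forms_cotangent[of \<xi> p] tzero_in_tangent_space[of p]
    unfolding cotangent_space_def by blast
  then show ?thesis by (simp add: tscale_def tzero_def)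
qed

lemma one_forms_add:
  "\<xi> \<in> one_forms M \<Longrightarrow> v \<in> tangent_space M p \<Longrightarrow> w \<in> tangent_space M p \<Longrightarrow>
    \<xi> p (tadd v w) = \<xi> p v + \<xi> p w"
  using one_forms_cotangent[of \<xi> p] by (auto simp: cotangent_space_def)

lemma one_forms_scale:
  "\<xi> \<in> one_forms M \<Longrightarrow> v \<in> tangent_space M p \<Longrightarrow> \<xi> p (tscale r v) = r * \<xi> p v"
  using one_forms_cotangent[of \<xi> p] by (auto simp: cotangent_space_def)

lemma one_forms_not_tangent: "\<xi> \<in> one_forms M \<Longrightarrow> v \<notin> tangent_space M p \<Longrightarrow> \<xi> p v = 0"
  using one_forms_cotangent[of \<xi> p] by (auto simp: cotangent_space_def)

text \<open>Constants are cut to 0 off \<open>points M\<close> to belong to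
  \<open>smooth_funs M\<close>. Fields and forms vanish there as well, so scaling by the true
  constant gives the same section; this lets -1 and \<epsilon> act as smooth functions.\<close>

lemma const_smooth_funs: "(\<lambda>p. if p \<in> points M then r else 0) \<in> smooth_funs M"
proof -
  have "smooth_on (chart_image c) ((\<lambda>p. if p \<in> points M then r else 0) \<circ> chart_inv c)"
    if c: "c \<in> atlas M" for c
    by (rule smooth_on_cong[OF open_chart_image[OF c] smooth_on_const[OF open_chart_image[OF c], of r]])
      (simp add: chart_inv_in_points[OF c])
  then show ?thesis by (simp add: smooth_funs_def)
qed

lemma vf_add_in_vfields: "X \<in> vfields M \<Longrightarrow> Y \<in> vfields M \<Longrightarrow> vf_add X Y \<in> vfields M"
  by (rule vfieldsI) (simp_all add: vf_add_def tadd_in_tangent_space vfields_tangent,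
      simp add: tadd_def smooth_on_add open_chart_image vfields_smooth)

lemma vf_scale_in_vfields:
  "f \<in> smooth_funs M \<Longrightarrow> X \<in> vfields M \<Longrightarrow> vf_scale f X \<in> vfields M"
  by (rule vfieldsI) (simp_all add: vf_scale_def tscale_in_tangent_space vfields_tangent,
      simp add: tscale_def smooth_on_scaleR open_chart_image vfields_smooth smooth_funs_smooth)

lemma vf_scale_const_eq:
  assumes "X \<in> vfields M"
  shows "vf_scale (\<lambda>p. r) X = vf_scale (\<lambda>p. if p \<in> points M then r else 0) X"
  using vfields_outside[OF assms] by (auto simp: vf_scale_def fun_eq_iff tscale_def tzero_def)

lemma vf_scale_const_in_vfields: "X \<in> vfields M \<Longrightarrow> vf_scale (\<lambda>p. r) X \<in> vfields M"
  using vf_scale_const_eq vf_scale_in_vfields const_smooth_funs by metis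

lemma zero_in_vfields: "(\<lambda>p. tzero) \<in> vfields M"
  by (rule vfieldsI) (simp_all add: tzero_in_tangent_space, simp add: tzero_def smooth_on_const open_chart_image)

lemma form_add_in_one_forms:
  "\<xi> \<in> one_forms M \<Longrightarrow> \<eta> \<in> one_forms M \<Longrightarrow> form_add \<xi> \<eta> \<in> one_forms M"
  by (rule one_formsI) (simp_all add: form_add_def one_forms_add one_forms_scale one_forms_not_tangent
      distrib_left smooth_on_add open_chart_image one_forms_smooth)

lemma form_scale_in_one_forms:
  "f \<in> smooth_funs M \<Longrightarrow> \<xi> \<in> one_forms M \<Longrightarrow> form_scale f \<xi> \<in> one_forms M"
  by (rule one_formsI) (simp_all add: form_scale_def one_forms_add one_forms_scale one_forms_not_tangent
      distrib_left smooth_on_mult open_chart_image one_forms_smooth smooth_funs_smooth)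

lemma form_scale_const_eq:
  assumes "\<xi> \<in> one_forms M"
  shows "form_scale (\<lambda>p. r) \<xi> = form_scale (\<lambda>p. if p \<in> points M then r else 0) \<xi>"
proof -
  have "\<xi> p v = 0" if "p \<notin> points M" for p v
    using one_forms_cotangent[OF assms, of p] one_forms_tzero[OF assms, of p] tangent_space_outside[OF that]
    by (cases "v = tzero") (auto simp: cotangent_space_def)
  then show ?thesis by (auto simp: form_scale_def fun_eq_iff)
qed

lemma form_scale_const_in_one_forms: "\<xi> \<in> one_forms M \<Longrightarrow> form_scale (\<lambda>p. r) \<xi> \<in> one_forms M"
  using form_scale_const_eq form_scale_in_one_forms const_smooth_funs by metis

lemma zero_in_one_forms: "(\<lambda>p v. 0) \<in> one_forms M"
  by (rule one_formsI) (simp_all add: smooth_on_const open_chart_image)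

lemma form_app_smooth:
  assumes \<xi>: "\<xi> \<in> one_forms M" and X: "X \<in> vfields M"
  shows "form_app \<xi> X \<in> smooth_funs M"
proof -
  have "smooth_on (chart_image c) (form_app \<xi> X \<circ> chart_inv c)" if c: "c \<in> atlas M" for c
  proof (rule smooth_on_cong[OF open_chart_image[OF c]])
    show "smooth_on (chart_image c) (\<lambda>x. \<Sum>i\<in>UNIV. X (chart_inv c x) c $ i *
        \<xi> (chart_inv c x) (coord_vec M c (chart_inv c x) (axis i 1)))"
      by (intro smooth_on_sum smooth_on_mult open_chart_image c vfields_smooth_nth[OF X c]
          one_forms_smooth[OF \<xi> c])
    show "(\<Sum>i\<in>UNIV. X (chart_inv c x) c $ i *
        \<xi> (chart_inv c x) (coord_vec M c (chart_inv c x) (axis i 1))) = (form_app \<xi> X \<circ> chart_inv c) x"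
      if "x \<in> chart_image c" for x
      using that c by (subst cotangent_space_expand[of c "chart_inv c x" "X (chart_inv c x)", symmetric])
        (auto simp: form_app_def vfields_tangent[OF X] one_forms_cotangent[OF \<xi>])
  qed
  then show ?thesis
    by (auto simp: smooth_funs_def form_app_def vfields_outside[OF X] one_forms_tzero[OF \<xi>])
qed

section \<open>Cut-offs and global extensions\<close>

text \<open>Extension by zero. Around points of the domain of \<open>c\<close> smoothness is given;
  every other point lies off the closed set \<open>K\<close>, and on the open complement of
  \<open>K\<close> the function is 0.\<close>

lemma smooth_on_cutoff:
  assumes c: "c \<in> atlas M" and d: "d \<in> atlas M"
    and K: "closedin (mtop M) K" "K \<subseteq> fst c"
    and zero: "\<And>q. q \<notin> K \<Longrightarrow> F q = 0"
    and smooth: "smooth_on (overlap d c) (\<lambda>x. F (chart_inv d x))"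
  shows "smooth_on (chart_image d) (\<lambda>x. F (chart_inv d x))"
proof (rule smooth_on_local)
  fix x assume x: "x \<in> chart_image d"
  show "\<exists>T. open T \<and> x \<in> T \<and> smooth_on T (\<lambda>x. F (chart_inv d x))"
  proof (cases "chart_inv d x \<in> fst c")
    case True
    then have "x \<in> overlap d c"
      using x by (intro image_eqI[of _ _ "chart_inv d x"]) auto
    then show ?thesis
      using open_overlap[OF d c] smooth by blast
  next
    case False
    let ?T = "snd d ` (fst d \<inter> (topspace (mtop M) - K))"
    have T: "open ?T"
      using K by (intro open_chart_Int[OF d]) auto
    have "x \<in> ?T"
      using x False K chart_subset[OF d] chart_inv_in[OF x]
      by (intro image_eqI[of _ _ "chart_inv d x"]) (auto simp: points_def)
    moreover have "smooth_on ?T (\<lambda>x. F (chart_inv d x))"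
      by (rule smooth_on_cong[OF T smooth_on_const[OF T, of 0]]) (use zero d in auto)
    ultimately show ?thesis
      using T by blast
  qed
qed

lemma smooth_on_chart_change:
  assumes c: "c \<in> atlas M" and d: "d \<in> atlas M" and f: "smooth_on (chart_image c) f"
  shows "smooth_on (overlap d c) (\<lambda>x. f (snd c (chart_inv d x)))"
  by (rule smooth_on_compose[OF open_overlap[OF d c] open_chart_image[OF c] smooth_transition[OF d c] f])
    (use c d in auto)

text \<open>The set \<open>K\<close> witnesses that the support stays inside the chart domain; it is
  closed in all of \<open>M\<close>, not just in that domain.\<close>

definition cutoff :: "('a, 'n) chart \<Rightarrow> ('a \<Rightarrow> real) \<Rightarrow> bool" where
  "cutoff c b \<longleftrightarrow> b \<in> smooth_funs M \<and> (\<exists>K. closedin (mtop M) K \<and> K \<subseteq> fst c \<and> (\<forall>q. q \<notin> K \<longrightarrow> b q = 0))"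

text \<open>The bump of radius \<open>r\<close> is nonzero exactly on the open ball, which serves as
  \<open>B\<close>, while the preimage of the closed ball confines the support; hence
  \<open>r\<close> is chosen with the closed ball inside the chart image.\<close>

lemma cutoff_exists:
  assumes c: "c \<in> atlas M" and p: "p \<in> fst c"
  obtains b B where "cutoff c b" "open B" "snd c p \<in> B" "B \<subseteq> chart_image c"
    "\<And>x. x \<in> B \<Longrightarrow> b (chart_inv c x) \<noteq> 0"
proof -
  obtain r where r: "r > 0" "cball (snd c p) r \<subseteq> chart_image c"
    using open_chart_image[OF c] p chart_in_image by (meson open_contains_cball)
  let ?K = "{q \<in> fst c. snd c q \<in> cball (snd c p) r}"
  define b where "b q = (if q \<in> fst c then bump (snd c p) r (snd c q) else 0)" for q
  have K: "closedin (mtop M) ?K"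
    by (rule closedin_chart_preimage[OF c compact_cball r(2)])
  have b0: "b q = 0" if "q \<notin> ?K" for q
    using that bump_nonzero_iff[OF r(1), of "snd c p" "snd c q"] by (auto simp: b_def)
  have "smooth_on (chart_image d) (\<lambda>x. b (chart_inv d x))" if d: "d \<in> atlas M" for d
  proof (rule smooth_on_cutoff[OF c d K _ b0])
    show "smooth_on (overlap d c) (\<lambda>x. b (chart_inv d x))"
      by (rule smooth_on_cong[OF open_overlap[OF d c]
            smooth_on_chart_change[OF c d smooth_on_subset[OF smooth_on_bump[of "snd c p" r]]]])
        (use d in \<open>auto simp: b_def\<close>)
  qed auto
  moreover have "b q = 0" if "q \<notin> points M" for q
    using that chart_subset[OF c] by (auto simp: b_def)
  ultimately have "b \<in> smooth_funs M"
    by (auto simp: smooth_funs_def comp_def)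
  then have "cutoff c b"
    unfolding cutoff_def using K b0 by blast
  moreover have "b (chart_inv c x) \<noteq> 0" if "x \<in> ball (snd c p) r" for x
  proof -
    have "x \<in> chart_image c" using that r(2) by auto
    then show ?thesis using that bump_nonzero_iff[OF r(1), of "snd c p" x] by (simp add: b_def)
  qed
  moreover have "ball (snd c p) r \<subseteq> chart_image c"
    using r(2) ball_subset_cball by blast
  ultimately show ?thesis
    using that[of b "ball (snd c p) r"] r(1) by simp
qed

text \<open>Off the chart domain \<open>F\<close> may be arbitrary, since \<open>b\<close> is 0
  there. This admits coordinate expressions that have a meaning only inside the chart.\<close>

lemma smooth_on_cutoff_scale:
  assumes c: "c \<in> atlas M" and d: "d \<in> atlas M" and b: "cutoff c b"
    and F: "smooth_on (overlap d c) (\<lambda>x. F (chart_inv d x))"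
  shows "smooth_on (chart_image d) (\<lambda>x. b (chart_inv d x) *\<^sub>R F (chart_inv d x))"
proof -
  obtain K where K: "closedin (mtop M) K" "K \<subseteq> fst c" "\<forall>q. q \<notin> K \<longrightarrow> b q = 0"
    using b by (auto simp: cutoff_def)
  have "smooth_on (chart_image d) (\<lambda>x. b (chart_inv d x))"
    using b d by (auto simp: cutoff_def smooth_funs_def comp_def)
  then have "smooth_on (overlap d c) (\<lambda>x. b (chart_inv d x) *\<^sub>R F (chart_inv d x))"
    by (intro smooth_on_scaleR open_overlap c d F) (rule smooth_on_subset[OF _ overlap_subset])
  then show ?thesis
    using K by (intro smooth_on_cutoff[OF c d, where F = "\<lambda>q. b q *\<^sub>R F q" and K = K]) auto
qed

lemma cutoff_outside: "cutoff c b \<Longrightarrow> q \<notin> fst c \<Longrightarrow> b q = 0"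
  by (auto simp: cutoff_def)

lemma cutoff_fun:
  assumes c: "c \<in> atlas M" and b: "cutoff c b" and f: "smooth_on (chart_image c) f"
  shows "(\<lambda>q. b q * f (snd c q)) \<in> smooth_funs M"
proof -
  have "smooth_on (chart_image d) (\<lambda>x. b (chart_inv d x) * f (snd c (chart_inv d x)))"
    if d: "d \<in> atlas M" for d
    using smooth_on_cutoff_scale[OF c d b smooth_on_chart_change[OF c d f]] by simp
  then show ?thesis
    using b by (auto simp: smooth_funs_def comp_def cutoff_def)
qed

text \<open>The coordinate field with constant components \<open>w\<close>, made global. Off the
  domain of \<open>c\<close> the value \<open>coord_vec M c q w\<close> carries no meaning; a
  cut-off \<open>b\<close> erases it.\<close>

definition cutoff_field :: "('a, 'n) chart \<Rightarrow> ('a \<Rightarrow> real) \<Rightarrow> real ^ 'n \<Rightarrow> ('a, 'n) vfield" where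
  "cutoff_field c b w = (\<lambda>q. tscale (b q) (coord_vec M c q w))"

lemma cutoff_field_in_vfields:
  assumes c: "c \<in> atlas M" and b: "cutoff c b"
  shows "cutoff_field c b w \<in> vfields M"
proof -
  have "cutoff_field c b w q \<in> tangent_space M q" for q
  proof (cases "q \<in> fst c")
    case True
    then show ?thesis
      using c by (simp add: cutoff_field_def tscale_in_tangent_space coord_vec_in_tangent_space)
  next
    case False
    then have "cutoff_field c b w q = tzero"
      using cutoff_outside[OF b] by (simp add: cutoff_field_def tscale_def tzero_def)
    then show ?thesis by (simp add: tzero_in_tangent_space)
  qed
  moreover have "smooth_on (chart_image d) (\<lambda>x. cutoff_field c b w (chart_inv d x) d)"
    if d: "d \<in> atlas M" for d
  proof -
    have "smooth_on (overlap d c) (\<lambda>x. transition_deriv c d (chart_inv c (snd c (chart_inv d x))) w)"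
      by (rule smooth_on_compose[OF open_overlap[OF d c] open_overlap[OF c d] smooth_transition[OF d c]
            smooth_transition_deriv[OF c d]]) (use c d in auto)
    then have "smooth_on (overlap d c) (\<lambda>x. coord_vec M c (chart_inv d x) w d)"
      by (rule smooth_on_cong[OF open_overlap[OF d c]]) (use c d in \<open>auto simp: coord_vec_def\<close>)
    from smooth_on_cutoff_scale[where F = "\<lambda>q. coord_vec M c q w d", OF c d b this]
    show ?thesis by (simp add: cutoff_field_def tscale_def)
  qed
  ultimately show ?thesis by (auto simp: vfields_def)
qed

definition cutoff_form :: "('a, 'n) chart \<Rightarrow> ('a \<Rightarrow> real) \<Rightarrow> real ^ 'n \<Rightarrow> ('a, 'n) form" where
  "cutoff_form c b w = (\<lambda>q v. if v \<in> tangent_space M q then b q * (w \<bullet> v c) else 0)"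

lemma cutoff_form_in_one_forms:
  assumes c: "c \<in> atlas M" and b: "cutoff c b"
  shows "cutoff_form c b w \<in> one_forms M"
proof -
  have "smooth_on (chart_image d)
      (\<lambda>x. cutoff_form c b w (chart_inv d x) (coord_vec M d (chart_inv d x) u))"
    if d: "d \<in> atlas M" for d u
  proof -
    have "smooth_on (overlap d c) (\<lambda>x. w \<bullet> transition_deriv d c (chart_inv d x) u)"
      by (rule smooth_on_linear[OF open_overlap[OF d c] bounded_linear_inner_right
            smooth_transition_deriv[OF d c]])
    then have "smooth_on (overlap d c) (\<lambda>x. w \<bullet> coord_vec M d (chart_inv d x) u c)"
      by (rule smooth_on_cong[OF open_overlap[OF d c]]) (use c d in \<open>auto simp: coord_vec_def\<close>)
    note smooth_on_cutoff_scale[where F = "\<lambda>q. w \<bullet> coord_vec M d q u c", OF c d b this]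
    then show ?thesis
      by (rule smooth_on_cong[OF open_chart_image[OF d]])
        (use d in \<open>simp add: cutoff_form_def coord_vec_in_tangent_space\<close>)
  qed
  then show ?thesis
    by (auto simp: one_forms_def cutoff_form_def cotangent_space_def tadd_in_tangent_space
        tscale_in_tangent_space) (auto simp: tadd_def tscale_def inner_add_right algebra_simps)
qed

text \<open>Allows pointwise statements to be tested on global fields, the only objects on which
  \<open>J\<close> is given.\<close>

lemma vfield_through:
  assumes v: "v \<in> tangent_space M p"
  obtains X where "X \<in> vfields M" "X p = v"
proof (cases "p \<in> points M")
  case True
  then obtain c where c: "c \<in> atlas M" "p \<in> fst c" by (rule chart_at_point)
  obtain b B where b: "cutoff c b" "snd c p \<in> B" "\<And>x. x \<in> B \<Longrightarrow> b (chart_inv c x) \<noteq> 0"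
    using cutoff_exists[OF c] by metis
  have "b p \<noteq> 0" using b(2) b(3)[of "snd c p"] c by simp
  \<comment> \<open>\<open>b p\<close> is nonzero but need not be 1, hence the factor
    \<open>inverse (b p)\<close>.\<close>
  then have "cutoff_field c b (inverse (b p) *\<^sub>R v c) p = coord_vec M c p (v c)"
    using c by (simp add: cutoff_field_def coord_vec_scale) (simp add: tscale_def)
  then show ?thesis
    using that[OF cutoff_field_in_vfields[OF c(1) b(1)]] coord_vec_of_tangent[OF _ v] c by simp
next
  case False
  then have "v = tzero" using v tangent_space_outside by auto
  then show ?thesis using that zero_in_vfields by blast
qed

lemma tangent_eq_0_if_one_forms:
  assumes v: "v \<in> tangent_space M p" and p: "p \<in> points M"
    and zero: "\<And>\<xi>. \<xi> \<in> one_forms M \<Longrightarrow> \<xi> p v = 0"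
  shows "v = tzero"
proof -
  obtain c where c: "c \<in> atlas M" "p \<in> fst c" using p by (rule chart_at_point)
  obtain b B where b: "cutoff c b" "snd c p \<in> B" "\<And>x. x \<in> B \<Longrightarrow> b (chart_inv c x) \<noteq> 0"
    using cutoff_exists[OF c] by metis
  have "b p \<noteq> 0" using b(2) b(3)[of "snd c p"] c by simp
  \<comment> \<open>Pairing \<open>v\<close> with the form whose coefficients are the components of
    \<open>v\<close> itself produces the Euclidean square of \<open>v c\<close>.\<close>
  moreover have "b p * (v c \<bullet> v c) = 0"
    using zero[OF cutoff_form_in_one_forms[OF c(1) b(1), of "v c"]] v by (simp add: cutoff_form_def)
  ultimately have "v c = tzero c" by (simp add: tzero_def)
  then show ?thesis
    using c v tzero_in_tangent_space by (intro tangent_eqI[of c p]) auto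
qed

lemma one_form_eqI:
  assumes "\<xi> \<in> one_forms M" "\<eta> \<in> one_forms M"
    and "\<And>X. X \<in> vfields M \<Longrightarrow> form_app \<xi> X = form_app \<eta> X"
  shows "\<xi> = \<eta>"
proof
  fix p
  show "\<xi> p = \<eta> p"
  proof (rule cotangent_eqI[of _ p])
    fix v assume "v \<in> tangent_space M p"
    then obtain X where "X \<in> vfields M" "X p = v" by (rule vfield_through)
    then show "\<xi> p v = \<eta> p v" using fun_cong[OF assms(3), of X p] by (simp add: form_app_def)
  qed (use assms one_forms_cotangent in auto)
qed

subsection \<open>Tensoriality and the dual endomorphism\<close>

lemma linear_coord_vec: "c \<in> charts_at M p \<Longrightarrow> linear (\<lambda>w. coord_vec M c p w d)"
  by (rule linearI) (simp_all add: coord_vec_add coord_vec_scale tadd_def tscale_def)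

lemma vf_endo_in: "vf_endo M J \<Longrightarrow> X \<in> vfields M \<Longrightarrow> J X \<in> vfields M"
  by (simp add: vf_endo_def)

lemma vf_endo_add:
  "vf_endo M J \<Longrightarrow> X \<in> vfields M \<Longrightarrow> Y \<in> vfields M \<Longrightarrow> J (vf_add X Y) = vf_add (J X) (J Y)"
  by (simp add: vf_endo_def)

lemma vf_endo_scale:
  "vf_endo M J \<Longrightarrow> f \<in> smooth_funs M \<Longrightarrow> X \<in> vfields M \<Longrightarrow> J (vf_scale f X) = vf_scale f (J X)"
  by (simp add: vf_endo_def)

lemma vf_endo_scale_const:
  "vf_endo M J \<Longrightarrow> X \<in> vfields M \<Longrightarrow> J (vf_scale (\<lambda>p. r) X) = vf_scale (\<lambda>p. r) (J X)"
  by (simp add: vf_scale_const_eq[of X] vf_scale_const_eq[of "J X"] vf_endo_in vf_endo_scale const_smooth_funs)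

text \<open>Membership is part of the claim because additivity of \<open>J\<close> is known on
  \<open>vfields M\<close> only, so the induction needs the partial sums to stay there. The empty
  sum is the case of scaling by 0.\<close>

lemma vf_endo_lincomb:
  assumes J: "vf_endo M J" and "finite I"
    and "\<And>i. i \<in> I \<Longrightarrow> f i \<in> smooth_funs M" "\<And>i. i \<in> I \<Longrightarrow> E i \<in> vfields M"
  shows "(\<lambda>p d. \<Sum>i\<in>I. f i p *\<^sub>R E i p d) \<in> vfields M \<and>
    J (\<lambda>p d. \<Sum>i\<in>I. f i p *\<^sub>R E i p d) = (\<lambda>p d. \<Sum>i\<in>I. f i p *\<^sub>R J (E i) p d)"
  using assms(2-4)
proof (induction I)
  case empty
  have scale0: "vf_scale (\<lambda>p. 0) X = (\<lambda>p. tzero)" for X :: "('a, 'n) vfield"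
    by (simp add: vf_scale_def tscale_def tzero_def)
  have "J (\<lambda>p. tzero) = (\<lambda>p. tzero)"
    using vf_endo_scale_const[OF J zero_in_vfields, of 0] by (simp add: scale0)
  then show ?case
    using zero_in_vfields by (simp add: tzero_def)
next
  case (insert i I)
  let ?S = "\<lambda>p d. \<Sum>i\<in>I. f i p *\<^sub>R E i p d"
  have S: "?S \<in> vfields M" "J ?S = (\<lambda>p d. \<Sum>i\<in>I. f i p *\<^sub>R J (E i) p d)"
    using insert by auto
  have fE: "f i \<in> smooth_funs M" "E i \<in> vfields M"
    using insert by auto
  have eq: "(\<lambda>p d. \<Sum>i\<in>insert i I. f i p *\<^sub>R E i p d) = vf_add (vf_scale (f i) (E i)) ?S"
    using insert by (simp add: vf_add_def vf_scale_def tadd_def tscale_def)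
  have "J (vf_add (vf_scale (f i) (E i)) ?S) =
      vf_add (vf_scale (f i) (J (E i))) (\<lambda>p d. \<Sum>i\<in>I. f i p *\<^sub>R J (E i) p d)"
    using fE S vf_endo_add[OF J] vf_endo_scale[OF J] vf_scale_in_vfields by simp
  moreover have "vf_add (vf_scale (f i) (E i)) ?S \<in> vfields M"
    using fE S by (simp add: vf_add_in_vfields vf_scale_in_vfields)
  ultimately show ?case
    unfolding eq using insert by (simp add: vf_add_def vf_scale_def tadd_def tscale_def)
qed

text \<open>Near \<open>p\<close> the field is a combination of cut-off coordinate fields,
  \<open>b\<^sup>2 X = \<Sum>\<^sub>i (b X\<^sup>i) (b \<partial>\<^sub>i)\<close>, with globally smooth coefficients.\<close>

lemma vf_endo_tensorial:
  assumes J: "vf_endo M J" and X: "X \<in> vfields M" and Y: "Y \<in> vfields M" and eq: "X p = Y p"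
  shows "J X p = J Y p"
proof (cases "p \<in> points M")
  case False
  then show ?thesis
    using vfields_outside vf_endo_in[OF J] X Y by metis
next
  case True
  then obtain c where c: "c \<in> atlas M" "p \<in> fst c" by (rule chart_at_point)
  obtain b B where b: "cutoff c b" "snd c p \<in> B" "\<And>x. x \<in> B \<Longrightarrow> b (chart_inv c x) \<noteq> 0"
    using cutoff_exists[OF c] by metis
  have bp: "b p \<noteq> 0" using b(2) b(3)[of "snd c p"] c by simp
  have b_smooth: "b \<in> smooth_funs M" using b(1) by (simp add: cutoff_def)
  define E where "E i = cutoff_field c b (axis i 1)" for i
  have E: "E i \<in> vfields M" for i
    unfolding E_def by (rule cutoff_field_in_vfields[OF c(1) b(1)])
  \<comment> \<open>The right-hand side sees \<open>Z\<close> only through \<open>Z p\<close>, as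
    the fields \<open>E i\<close> do not involve \<open>Z\<close>. Dividing by
    \<open>b p * b p\<close> then gives the claim.\<close>
  have expand: "(b p * b p) *\<^sub>R J Z p d = (\<Sum>i\<in>UNIV. (b p * Z p c $ i) *\<^sub>R J (E i) p d)"
    if Z: "Z \<in> vfields M" for Z d
  proof -
    define f where "f i q = b q * Z q c $ i" for i q
    have f: "f i \<in> smooth_funs M" for i
    proof -
      have "(\<lambda>q. b q * Z (chart_inv c (snd c q)) c $ i) \<in> smooth_funs M"
        by (rule cutoff_fun[OF c(1) b(1) vfields_smooth_nth[OF Z c(1)]])
      moreover have "b q * Z (chart_inv c (snd c q)) c $ i = f i q" for q
        using c(1) cutoff_outside[OF b(1)] by (cases "q \<in> fst c") (auto simp: f_def)
      ultimately show ?thesis by simp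
    qed
    have "vf_scale b (vf_scale b Z) = (\<lambda>q d. \<Sum>i\<in>UNIV. f i q *\<^sub>R E i q d)"
    proof (intro ext)
      fix q d
      show "vf_scale b (vf_scale b Z) q d = (\<Sum>i\<in>UNIV. f i q *\<^sub>R E i q d)"
      proof (cases "q \<in> fst c")
        case True
        then have cq: "c \<in> charts_at M q" using c by simp
        note lin = linear_coord_vec[OF cq, of d]
        have "Z q d = coord_vec M c q (Z q c) d"
          by (simp add: coord_vec_of_tangent[OF cq vfields_tangent[OF Z]])
        also have "Z q c = (\<Sum>i\<in>UNIV. Z q c $ i *\<^sub>R axis i (1::real))"
          using basis_expansion[of "Z q c"] by (simp add: scalar_mult_eq_scaleR)
        also have "coord_vec M c q (\<Sum>i\<in>UNIV. Z q c $ i *\<^sub>R axis i (1::real)) d =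
            (\<Sum>i\<in>UNIV. Z q c $ i *\<^sub>R coord_vec M c q (axis i 1) d)"
          by (simp only: linear_sum[OF lin] linear_cmul[OF lin])
        finally have "Z q d = (\<Sum>i\<in>UNIV. Z q c $ i *\<^sub>R coord_vec M c q (axis i 1) d)" .
        then show ?thesis
          by (simp add: vf_scale_def tscale_def f_def E_def cutoff_field_def scaleR_sum_right algebra_simps)
      next
        case False
        then show ?thesis
          using cutoff_outside[OF b(1)] by (simp add: vf_scale_def tscale_def f_def)
      qed
    qed
    then have "J (vf_scale b (vf_scale b Z)) = (\<lambda>q d. \<Sum>i\<in>UNIV. f i q *\<^sub>R J (E i) q d)"
      using vf_endo_lincomb[OF J, of UNIV f E] f E by simp
    moreover have "J (vf_scale b (vf_scale b Z)) = vf_scale b (vf_scale b (J Z))"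
      using Z b_smooth by (simp add: vf_endo_scale[OF J] vf_scale_in_vfields)
    ultimately have "vf_scale b (vf_scale b (J Z)) p d = (\<Sum>i\<in>UNIV. f i p *\<^sub>R J (E i) p d)"
      by simp
    then show ?thesis by (simp add: vf_scale_def tscale_def f_def)
  qed
  show ?thesis
  proof
    fix d
    have "(b p * b p) *\<^sub>R J X p d = (b p * b p) *\<^sub>R J Y p d"
      unfolding expand[OF X] expand[OF Y] eq ..
    then show "J X p d = J Y p d" using bp by simp
  qed
qed

text \<open>A concrete candidate for the form described in \<open>dual_endo\<close>: extend
  \<open>v\<close> to a global field, apply \<open>J\<close>, evaluate. By tensoriality of
  \<open>J\<close> the chosen extension does not matter.\<close>

definition dual_form :: "(('a, 'n) vfield \<Rightarrow> ('a, 'n) vfield) \<Rightarrow> ('a, 'n) form \<Rightarrow> ('a, 'n) form" where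
  "dual_form J \<xi> = (\<lambda>p v. if v \<in> tangent_space M p
     then \<xi> p (J (SOME X. X \<in> vfields M \<and> X p = v) p) else 0)"

lemma dual_form_app:
  assumes J: "vf_endo M J" and X: "X \<in> vfields M"
  shows "dual_form J \<xi> p (X p) = \<xi> p (J X p)"
proof -
  let ?Y = "SOME Y. Y \<in> vfields M \<and> Y p = X p"
  have "?Y \<in> vfields M \<and> ?Y p = X p"
    by (rule someI[of _ X]) (simp add: X)
  then have "J ?Y p = J X p"
    using vf_endo_tensorial[OF J _ X] by blast
  then show ?thesis
    by (simp add: dual_form_def vfields_tangent[OF X])
qed

text \<open>The algebraic conditions are inherited from global extensions. Smoothness cannot be read
  off extensions chosen point by point, so near each point one field \<open>?W\<close> is used for
  all base points: \<open>\<xi> (J ?W)\<close> is smooth and equals \<open>b\<close> times the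
  wanted function.\<close>

lemma dual_form_in_one_forms:
  assumes J: "vf_endo M J" and \<xi>: "\<xi> \<in> one_forms M"
  shows "dual_form J \<xi> \<in> one_forms M"
proof (rule one_formsI)
  fix p v w assume "v \<in> tangent_space M p" "w \<in> tangent_space M p"
  then obtain X Y where XY: "X \<in> vfields M" "X p = v" "Y \<in> vfields M" "Y p = w"
    using vfield_through by metis
  have "dual_form J \<xi> p (vf_add X Y p) = \<xi> p (vf_add (J X) (J Y) p)"
    using XY by (simp add: dual_form_app[OF J] vf_add_in_vfields vf_endo_add[OF J])
  also have "\<dots> = \<xi> p (J X p) + \<xi> p (J Y p)"
    using XY vf_endo_in[OF J] vfields_tangent by (simp add: vf_add_def one_forms_add[OF \<xi>])
  finally show "dual_form J \<xi> p (tadd v w) = dual_form J \<xi> p v + dual_form J \<xi> p w"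
    using dual_form_app[OF J XY(1), of \<xi> p] dual_form_app[OF J XY(3), of \<xi> p] XY
    by (simp add: vf_add_def)
next
  fix p v and r :: real assume "v \<in> tangent_space M p"
  then obtain X where X: "X \<in> vfields M" "X p = v"
    using vfield_through by metis
  have "dual_form J \<xi> p (vf_scale (\<lambda>p. r) X p) = \<xi> p (vf_scale (\<lambda>p. r) (J X) p)"
    using X by (simp add: dual_form_app[OF J] vf_scale_const_in_vfields vf_endo_scale_const[OF J])
  also have "\<dots> = r * \<xi> p (J X p)"
    using X vf_endo_in[OF J] vfields_tangent by (simp add: vf_scale_def one_forms_scale[OF \<xi>])
  finally show "dual_form J \<xi> p (tscale r v) = r * dual_form J \<xi> p v"
    using dual_form_app[OF J X(1), of \<xi> p] X by (simp add: vf_scale_def)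
next
  show "dual_form J \<xi> p v = 0" if "v \<notin> tangent_space M p" for p v
    using that by (simp add: dual_form_def)
next
  fix c w assume c: "c \<in> atlas M"
  show "smooth_on (chart_image c) (\<lambda>x. dual_form J \<xi> (chart_inv c x) (coord_vec M c (chart_inv c x) w))"
  proof (rule smooth_on_local)
    fix x assume x: "x \<in> chart_image c"
    obtain b B where b: "cutoff c b" and B: "open B" "x \<in> B" "B \<subseteq> chart_image c"
      "\<And>x. x \<in> B \<Longrightarrow> b (chart_inv c x) \<noteq> 0"
      using cutoff_exists[OF c chart_inv_in[OF x]] x by (metis chart_chart_inv)
    let ?W = "cutoff_field c b w"
    have W: "?W \<in> vfields M" by (rule cutoff_field_in_vfields[OF c b])
    have "form_app \<xi> (J ?W) \<in> smooth_funs M"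
      by (rule form_app_smooth[OF \<xi> vf_endo_in[OF J W]])
    moreover have "b \<in> smooth_funs M" using b by (simp add: cutoff_def)
    ultimately have "smooth_on B (\<lambda>x. form_app \<xi> (J ?W) (chart_inv c x) / b (chart_inv c x))"
      using B c smooth_funs_smooth smooth_on_subset by (intro smooth_on_divide) blast+
    then have "smooth_on B (\<lambda>x. dual_form J \<xi> (chart_inv c x) (coord_vec M c (chart_inv c x) w))"
    proof (rule smooth_on_cong[OF B(1)])
      fix y assume y: "y \<in> B"
      let ?q = "chart_inv c y"
      have q: "?q \<in> fst c" using y B by auto
      let ?v = "coord_vec M c ?q w"
      have v: "?v \<in> tangent_space M ?q" using q c by (simp add: coord_vec_in_tangent_space)
      then obtain V where V: "V \<in> vfields M" "V ?q = ?v"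
        using vfield_through by metis
      \<comment> \<open>The function \<open>b\<close> may be frozen at its value at
        \<open>?q\<close>, since tensoriality compares the two fields at \<open>?q\<close>
        only.\<close>
      have "?W ?q = vf_scale (\<lambda>p. b ?q) V ?q"
        using V by (simp add: cutoff_field_def vf_scale_def)
      then have "J ?W ?q = vf_scale (\<lambda>p. b ?q) (J V) ?q"
        using vf_endo_tensorial[OF J W vf_scale_const_in_vfields[OF V(1)], of ?q "b ?q"]
          vf_endo_scale_const[OF J V(1)] by simp
      then have "form_app \<xi> (J ?W) ?q = b ?q * \<xi> ?q (J V ?q)"
        using vfields_tangent[OF vf_endo_in[OF J V(1)]]
        by (simp add: form_app_def vf_scale_def one_forms_scale[OF \<xi>])
      then show "form_app \<xi> (J ?W) ?q / b ?q = dual_form J \<xi> ?q ?v"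
        using dual_form_app[OF J V(1), of \<xi> ?q] V(2) B(4)[OF y] by simp
    qed
    then show "\<exists>T. open T \<and> x \<in> T \<and>
        smooth_on T (\<lambda>x. dual_form J \<xi> (chart_inv c x) (coord_vec M c (chart_inv c x) w))"
      using B by blast
  qed
qed

text \<open>Existence comes from \<open>dual_form\<close>, uniqueness from the fact that global
  fields separate forms. Afterwards \<open>dual_endo\<close> is used only through these two
  properties.\<close>

lemma dual_endo:
  assumes J: "vf_endo M J" and \<xi>: "\<xi> \<in> one_forms M"
  shows "dual_endo M J \<xi> \<in> one_forms M"
    and "X \<in> vfields M \<Longrightarrow> form_app (dual_endo M J \<xi>) X = form_app \<xi> (J X)"
proof -
  have app: "form_app (dual_form J \<xi>) X = form_app \<xi> (J X)" if "X \<in> vfields M" for X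
    using dual_form_app[OF J that] by (simp add: form_app_def)
  have "dual_endo M J \<xi> = dual_form J \<xi>"
    unfolding dual_endo_def
    by (rule the_equality) (use dual_form_in_one_forms[OF J \<xi>] app one_form_eqI in auto)
  then show "dual_endo M J \<xi> \<in> one_forms M"
    "X \<in> vfields M \<Longrightarrow> form_app (dual_endo M J \<xi>) X = form_app \<xi> (J X)"
    using dual_form_in_one_forms[OF J \<xi>] app by auto
qed

lemma form_app_form_add: "form_app (form_add \<xi> \<eta>) X p = form_app \<xi> X p + form_app \<eta> X p"
  by (simp add: form_app_def form_add_def)

lemma form_app_form_scale: "form_app (form_scale f \<xi>) X p = f p * form_app \<xi> X p"
  by (simp add: form_app_def form_scale_def)

lemma form_app_vf_add:
  "\<xi> \<in> one_forms M \<Longrightarrow> X \<in> vfields M \<Longrightarrow> Y \<in> vfields M \<Longrightarrow>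
    form_app \<xi> (vf_add X Y) p = form_app \<xi> X p + form_app \<xi> Y p"
  by (simp add: form_app_def vf_add_def one_forms_add vfields_tangent)

lemma form_app_vf_scale:
  "\<xi> \<in> one_forms M \<Longrightarrow> X \<in> vfields M \<Longrightarrow> form_app \<xi> (vf_scale f X) p = f p * form_app \<xi> X p"
  by (simp add: form_app_def vf_scale_def one_forms_scale vfields_tangent)

lemmas form_app_simps = form_app_form_add form_app_form_scale form_app_vf_add form_app_vf_scale

lemma dual_endo_add:
  assumes J: "vf_endo M J" and "\<xi> \<in> one_forms M" "\<eta> \<in> one_forms M"
  shows "dual_endo M J (form_add \<xi> \<eta>) = form_add (dual_endo M J \<xi>) (dual_endo M J \<eta>)"
  using assms by (intro one_form_eqI)
    (simp_all add: dual_endo form_add_in_one_forms, simp add: fun_eq_iff form_app_simps dual_endo)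

lemma dual_endo_scale:
  assumes J: "vf_endo M J" and "\<xi> \<in> one_forms M" "f \<in> smooth_funs M"
  shows "dual_endo M J (form_scale f \<xi>) = form_scale f (dual_endo M J \<xi>)"
  using assms by (intro one_form_eqI)
    (simp_all add: dual_endo form_scale_in_one_forms, simp add: fun_eq_iff form_app_simps dual_endo)

lemma smooth_funs_outside: "f \<in> smooth_funs M \<Longrightarrow> p \<notin> points M \<Longrightarrow> f p = 0"
  by (simp add: smooth_funs_def)

lemma smooth_funs_add:
  "f \<in> smooth_funs M \<Longrightarrow> h \<in> smooth_funs M \<Longrightarrow> (\<lambda>p. f p + h p) \<in> smooth_funs M"
  by (rule smooth_funsI) (simp_all add: smooth_funs_outside smooth_on_add open_chart_image smooth_funs_smooth)

lemma smooth_funs_cmult: "f \<in> smooth_funs M \<Longrightarrow> (\<lambda>p. r * f p) \<in> smooth_funs M"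
  by (rule smooth_funsI)
    (simp_all add: smooth_funs_outside smooth_on_mult smooth_on_const open_chart_image smooth_funs_smooth)

text \<open>For nondegeneracy, pairing with pure forms detects the vector part and pairing with pure
  fields the form part; cut-off forms and global extensions supply enough test sections.\<close>

lemma gen_metric_G0: "gen_metric M G0"
  unfolding gen_metric_def
proof (intro conjI ballI impI)
  fix p and u :: "('a, 'n) gsection"
  assume p: "p \<in> points M" and u: "u \<in> gsections M" and zero: "\<forall>v\<in>gsections M. G0 u v p = 0"
  obtain X \<xi> where u_eq: "u = (X, \<xi>)" "X \<in> vfields M" "\<xi> \<in> one_forms M"
    using u by (auto simp: gsections_def)
  have *: "form_app \<xi> Y p + form_app \<eta> X p = 0" if "Y \<in> vfields M" "\<eta> \<in> one_forms M" for Y \<eta>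
    using zero that u_eq by (fastforce simp: gsections_def G0_def)
  have "\<eta> p (X p) = 0" if "\<eta> \<in> one_forms M" for \<eta>
    using *[OF zero_in_vfields that] one_forms_tzero[OF u_eq(3)] by (simp add: form_app_def)
  then have "X p = tzero"
    by (intro tangent_eq_0_if_one_forms[OF vfields_tangent[OF u_eq(2)] p])
  then show "fst u p = tzero" by (simp add: u_eq)
  have "\<xi> p = (\<lambda>v. 0)"
  proof (rule cotangent_eqI[OF one_forms_cotangent[OF u_eq(3)] one_forms_cotangent[OF zero_in_one_forms]])
    fix v assume "v \<in> tangent_space M p"
    then obtain Y where "Y \<in> vfields M" "Y p = v" by (rule vfield_through)
    then show "\<xi> p v = 0"
      using *[OF _ zero_in_one_forms] by (force simp: form_app_def)
  qed
  then show "snd u p = (\<lambda>v. 0)" by (simp add: u_eq)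
next
  fix u v :: "('a, 'n) gsection" assume "u \<in> gsections M" "v \<in> gsections M"
  then show "G0 u v \<in> smooth_funs M"
    unfolding G0_def by (intro smooth_funs_cmult smooth_funs_add form_app_smooth)
      (auto simp: gsections_def)
qed (auto simp: gsections_def G0_def gs_add_def gs_scale_def fun_eq_iff form_app_simps algebra_simps)

lemma gsections_cases:
  assumes "u \<in> gsections M"
  obtains X \<xi> where "u = (X, \<xi>)" "X \<in> vfields M" "\<xi> \<in> one_forms M"
  using assms by (auto simp: gsections_def)

end

lemma norden_imp_compatible:
  assumes "gen_almost_norden M K G"
  shows "compatible M K G"
  using assms unfolding gen_almost_norden_def gen_almost_complex_def compatible_def
  by (intro conjI exI[of _ "-1"]) auto

section \<open>Metric manifolds\<close>

locale metric_mfd = smooth_mfd M for M :: "('a, 'n::finite) manifold" +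
  fixes \<epsilon> :: real and J :: "('a, 'n) vfield \<Rightarrow> ('a, 'n) vfield" and g :: "('a, 'n) tensor2"
  assumes metric: "metric_manifold (-1) \<epsilon> M J g"
begin

lemma J_endo: "vf_endo M J"
  using metric by (simp add: metric_manifold_def)

lemmas J_in = vf_endo_in[OF J_endo]

lemma J_J: "X \<in> vfields M \<Longrightarrow> J (J X) = vf_scale (\<lambda>p. -1) X"
  using metric by (simp add: metric_manifold_def)

lemma eps_sq: "\<epsilon> * \<epsilon> = 1"
  using metric by (auto simp: metric_manifold_def)

lemma g_symmetric_tensor: "symmetric_tensor M g"
  using metric by (auto simp: metric_manifold_def riemannian_def pseudo_riemannian_def)

lemma g_sym:
  "p \<in> points M \<Longrightarrow> v \<in> tangent_space M p \<Longrightarrow> w \<in> tangent_space M p \<Longrightarrow> g p v w = g p w v"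
  using g_symmetric_tensor by (simp add: symmetric_tensor_def)

lemma g_add:
  assumes "p \<in> points M" "u \<in> tangent_space M p" "v \<in> tangent_space M p" "w \<in> tangent_space M p"
  shows "g p (tadd u v) w = g p u w + g p v w" "g p w (tadd u v) = g p w u + g p w v"
proof -
  show *: "g p (tadd u v) w = g p u w + g p v w"
    using g_symmetric_tensor assms by (simp add: symmetric_tensor_def)
  show "g p w (tadd u v) = g p w u + g p w v"
    using * g_sym[OF assms(1)] assms tadd_in_tangent_space by simp
qed

lemma g_scale:
  assumes "p \<in> points M" "v \<in> tangent_space M p" "w \<in> tangent_space M p"
  shows "g p (tscale r v) w = r * g p v w" "g p w (tscale r v) = r * g p w v"
proof -
  show *: "g p (tscale r v) w = r * g p v w"
    using g_symmetric_tensor assms by (simp add: symmetric_tensor_def)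
  show "g p w (tscale r v) = r * g p w v"
    using * g_sym[OF assms(1)] assms tscale_in_tangent_space by simp
qed

lemma g_smooth:
  "c \<in> atlas M \<Longrightarrow> smooth_on (chart_image c)
    (\<lambda>x. g (chart_inv c x) (coord_vec M c (chart_inv c x) v) (coord_vec M c (chart_inv c x) w))"
  using g_symmetric_tensor by (simp add: symmetric_tensor_def)

text \<open>Positive definiteness gives this by testing with \<open>w = v\<close>; in the
  pseudo-Riemannian case it is part of the definition.\<close>

lemma g_nondegenerate:
  assumes "p \<in> points M" "v \<in> tangent_space M p" "\<And>w. w \<in> tangent_space M p \<Longrightarrow> g p v w = 0"
  shows "v = tzero"
proof (cases "riemannian M g")
  case True
  then show ?thesis
    using assms by (force simp: riemannian_def positive_definite_def)
next
  case False
  then have "nondegenerate M g"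
    using metric by (simp add: metric_manifold_def pseudo_riemannian_def)
  then show ?thesis
    using assms by (simp add: nondegenerate_def)
qed

lemma g_expand:
  assumes "c \<in> atlas M" "p \<in> fst c" "v \<in> tangent_space M p" "w \<in> tangent_space M p"
  shows "g p v w = (\<Sum>i\<in>UNIV. v c $ i * g p (coord_vec M c p (axis i 1)) w)"
proof -
  have p: "p \<in> points M" using assms chart_subset by blast
  show ?thesis
    using assms by (intro linear_on_tangent_space_expand[where a = "\<lambda>v. g p v w"])
      (auto simp: g_add[OF p] g_scale[OF p])
qed

section \<open>Lowering and raising indices\<close>

lemma flat_in_one_forms:
  assumes X: "X \<in> vfields M"
  shows "flat M g X \<in> one_forms M"
proof (rule one_formsI)
  fix p v w assume "v \<in> tangent_space M p" "w \<in> tangent_space M p"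
  then show "flat M g X p (tadd v w) = flat M g X p v + flat M g X p w"
    by (simp add: flat_def g_add vfields_tangent[OF X] tadd_in_tangent_space)
next
  fix p v and r :: real assume "v \<in> tangent_space M p"
  then show "flat M g X p (tscale r v) = r * flat M g X p v"
    by (simp add: flat_def g_scale vfields_tangent[OF X] tscale_in_tangent_space)
next
  show "flat M g X p v = 0" if "v \<notin> tangent_space M p" for p v
    using that by (simp add: flat_def)
next
  fix c w assume c: "c \<in> atlas M"
  have "smooth_on (chart_image c) (\<lambda>x. \<Sum>i\<in>UNIV. X (chart_inv c x) c $ i *
      g (chart_inv c x) (coord_vec M c (chart_inv c x) (axis i 1)) (coord_vec M c (chart_inv c x) w))"
    by (intro smooth_on_sum smooth_on_mult open_chart_image c vfields_smooth_nth[OF X c] g_smooth)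
  then show "smooth_on (chart_image c) (\<lambda>x. flat M g X (chart_inv c x) (coord_vec M c (chart_inv c x) w))"
  proof (rule smooth_on_cong[OF open_chart_image[OF c]])
    fix x assume x: "x \<in> chart_image c"
    let ?p = "chart_inv c x" and ?w = "coord_vec M c (chart_inv c x) w"
    have w: "?w \<in> tangent_space M ?p"
      using c x by (simp add: coord_vec_in_tangent_space)
    show "(\<Sum>i\<in>UNIV. X ?p c $ i * g ?p (coord_vec M c ?p (axis i 1)) ?w) = flat M g X ?p ?w"
      using g_expand[OF c chart_inv_in[OF x] vfields_tangent[OF X] w] w
      by (simp add: flat_def chart_inv_in_points[OF c x])
  qed
qed

lemma form_app_flat: "Y \<in> vfields M \<Longrightarrow> form_app (flat M g X) Y = metric_app M g X Y"
  by (auto simp: form_app_def flat_def metric_app_def vfields_tangent)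

lemma flat_inj:
  assumes X: "X \<in> vfields M" and Y: "Y \<in> vfields M" and eq: "flat M g X = flat M g Y"
  shows "X = Y"
proof
  fix p
  show "X p = Y p"
  proof (cases "p \<in> points M")
    case False
    then show ?thesis using X Y vfields_outside by simp
  next
    case p: True
    note T = vfields_tangent[OF X, of p] vfields_tangent[OF Y, of p]
    have "g p (tadd (X p) (tscale (-1) (Y p))) w = 0" if "w \<in> tangent_space M p" for w
    proof -
      have "flat M g X p w = flat M g Y p w" by (simp add: eq)
      then show ?thesis
        using that T p by (simp add: flat_def g_add g_scale tscale_in_tangent_space)
    qed
    then have "tadd (X p) (tscale (-1) (Y p)) = tzero"
      using T p by (intro g_nondegenerate) (auto intro: tadd_in_tangent_space tscale_in_tangent_space)
    then have "X p d + - Y p d = 0" for d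
      by (auto simp: tadd_def tscale_def tzero_def dest: fun_cong[of _ _ d])
    then show ?thesis by (auto simp: fun_eq_iff)
  qed
qed

definition gram :: "('a, 'n) chart \<Rightarrow> 'a \<Rightarrow> real ^ 'n ^ 'n" where
  "gram c p = (\<chi> i j. g p (coord_vec M c p (axis i 1)) (coord_vec M c p (axis j 1)))"

definition form_coords :: "('a, 'n) chart \<Rightarrow> 'a \<Rightarrow> (('a, 'n) tvec \<Rightarrow> real) \<Rightarrow> real ^ 'n" where
  "form_coords c p a = (\<chi> i. a (coord_vec M c p (axis i 1)))"

text \<open>Entry \<open>i\<close> of the product sums \<open>g(e\<^sub>i, e\<^sub>j)\<close>
  against the components of \<open>v\<close>; by symmetry of \<open>g\<close> this is
  \<open>g(v, e\<^sub>i)\<close>.\<close>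

lemma gram_mult:
  assumes c: "c \<in> atlas M" "p \<in> fst c" and v: "v \<in> tangent_space M p"
  shows "gram c p *v v c = form_coords c p (g p v)"
proof -
  have p: "p \<in> points M" using c chart_subset by blast
  have e: "coord_vec M c p u \<in> tangent_space M p" for u
    using c by (simp add: coord_vec_in_tangent_space)
  show ?thesis
    using g_expand[OF c v e] g_sym[OF p e e]
    by (simp add: vec_eq_iff gram_def form_coords_def matrix_vector_mult_def mult.commute)
qed

text \<open>Both \<open>g p v\<close> and \<open>a\<close> are linear, so equality need only be
  tested on the coordinate basis; raising an index becomes a linear system with matrix
  \<open>gram c p\<close>.\<close>

lemma sharp_pointwise_iff:
  assumes c: "c \<in> atlas M" "p \<in> fst c" and v: "v \<in> tangent_space M p" and a: "a \<in> cotangent_space M p"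
  shows "(\<forall>w\<in>tangent_space M p. g p v w = a w) \<longleftrightarrow> gram c p *v v c = form_coords c p a"
proof -
  have p: "p \<in> points M" using c chart_subset by blast
  have cp: "c \<in> charts_at M p" using c by simp
  have e: "coord_vec M c p u \<in> tangent_space M p" for u
    using c by (simp add: coord_vec_in_tangent_space)
  show ?thesis
  proof
    assume "\<forall>w\<in>tangent_space M p. g p v w = a w"
    then show "gram c p *v v c = form_coords c p a"
      using e by (simp add: gram_mult[OF c v] form_coords_def)
  next
    assume "gram c p *v v c = form_coords c p a"
    then have eq: "g p v (coord_vec M c p (axis i 1)) = a (coord_vec M c p (axis i 1))" for i
      by (simp add: gram_mult[OF c v] form_coords_def vec_eq_iff)
    show "\<forall>w\<in>tangent_space M p. g p v w = a w"
    proof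
      fix w assume w: "w \<in> tangent_space M p"
      have "g p v w = (\<Sum>i\<in>UNIV. w c $ i * g p v (coord_vec M c p (axis i 1)))"
        using g_expand[OF c w v] g_sym[OF p v] w e by simp
      also have "\<dots> = a w"
        by (simp add: eq cotangent_space_expand[OF cp w a])
      finally show "g p v w = a w" .
    qed
  qed
qed

text \<open>A kernel vector of the Gram matrix holds the components of a tangent vector orthogonal
  to its whole tangent space, which nondegeneracy forces to be 0.\<close>

lemma det_gram_nonzero:
  assumes c: "c \<in> atlas M" "p \<in> fst c"
  shows "det (gram c p) \<noteq> 0"
proof -
  have cp: "c \<in> charts_at M p" using c by simp
  have "u = 0" if u: "gram c p *v u = 0" for u
  proof -
    let ?v = "coord_vec M c p u"
    have v: "?v \<in> tangent_space M p" "?v c = u"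
      using cp by (simp_all add: coord_vec_in_tangent_space coord_vec_self)
    have "(\<lambda>w. 0) \<in> cotangent_space M p" by (simp add: cotangent_space_def)
    moreover have "gram c p *v ?v c = form_coords c p (\<lambda>w. 0)"
      by (simp add: v u form_coords_def vec_eq_iff)
    ultimately have "\<forall>w\<in>tangent_space M p. g p ?v w = 0"
      using sharp_pointwise_iff[OF c v(1)] by blast
    then have "?v = tzero"
      using chart_subset[OF c(1)] c(2) v by (intro g_nondegenerate) auto
    then show "u = 0" using v(2) by (simp add: tzero_def)
  qed
  then show ?thesis
    by (metis invertible_det_nz invertible_left_inverse matrix_left_invertible_ker)
qed

text \<open>Cramer's rule enters twice: at each point it gives a solution, and in each chart it
  gives a smooth formula. By uniqueness the pointwise solutions, found in unrelated charts, must
  obey that formula.\<close>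

lemma flat_surj:
  assumes \<xi>: "\<xi> \<in> one_forms M"
  obtains X where "X \<in> vfields M" "flat M g X = \<xi>"
proof -
  note coT = one_forms_cotangent[OF \<xi>]
  have "\<exists>v\<in>tangent_space M p. p \<in> points M \<longrightarrow> (\<forall>w\<in>tangent_space M p. g p v w = \<xi> p w)" for p
  proof (cases "p \<in> points M")
    case True
    then obtain c where c: "c \<in> atlas M" "p \<in> fst c" by (rule chart_at_point)
    then have cp: "c \<in> charts_at M p" by simp
    have "\<exists>u. gram c p *v u = form_coords c p (\<xi> p)"
      unfolding cramer[OF det_gram_nonzero[OF c]] by (rule exI, rule refl)
    then obtain u where u: "gram c p *v u = form_coords c p (\<xi> p)" ..
    have "gram c p *v coord_vec M c p u c = form_coords c p (\<xi> p)"
      by (simp add: coord_vec_self[OF cp] u)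
    then show ?thesis
      using sharp_pointwise_iff[OF c coord_vec_in_tangent_space[OF cp] coT]
        coord_vec_in_tangent_space[OF cp] by blast
  next
    case False
    then show ?thesis using tzero_in_tangent_space by blast
  qed
  then obtain X where X: "\<And>p. X p \<in> tangent_space M p"
    "\<And>p w. p \<in> points M \<Longrightarrow> w \<in> tangent_space M p \<Longrightarrow> g p (X p) w = \<xi> p w"
    by metis
  have "X \<in> vfields M"
  proof (rule vfieldsI[OF X(1)])
    fix c assume c: "c \<in> atlas M"
    let ?S = "chart_image c"
    let ?A = "\<lambda>x. gram c (chart_inv c x)" and ?b = "\<lambda>x. form_coords c (chart_inv c x) (\<xi> (chart_inv c x))"
    have A: "smooth_on ?S (\<lambda>x. ?A x $ i $ j)" for i j
      by (simp add: gram_def g_smooth[OF c])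
    have b: "smooth_on ?S (\<lambda>x. ?b x $ i)" for i
      by (simp add: form_coords_def one_forms_smooth[OF \<xi> c])
    \<comment> \<open>The Gram matrix with column \<open>k\<close> replaced by the right-hand side,
      as in Cramer's rule.\<close>
    let ?C = "\<lambda>x k. \<chi> i j. if j = k then ?b x $ i else ?A x $ i $ j"
    have C: "smooth_on ?S (\<lambda>x. ?C x k $ i $ j)" for i j k
      by (cases "j = k") (simp_all add: A b)
    have "smooth_on ?S (\<lambda>x. det (?C x k) / det (?A x))" for k
      using det_gram_nonzero[OF c]
      by (intro smooth_on_divide smooth_on_det open_chart_image c A C) auto
    then have "smooth_on ?S (\<lambda>x. \<chi> k. det (?C x k) / det (?A x))"
      by (simp add: smooth_on_vec_iff open_chart_image c)
    then show "smooth_on ?S (\<lambda>x. X (chart_inv c x) c)"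
    proof (rule smooth_on_cong[OF open_chart_image[OF c]])
      fix x assume x: "x \<in> ?S"
      have "?A x *v X (chart_inv c x) c = ?b x"
        using sharp_pointwise_iff[OF c chart_inv_in[OF x] X(1) coT] X(2) chart_inv_in_points[OF c x]
        by blast
      then show "(\<chi> k. det (?C x k) / det (?A x)) = X (chart_inv c x) c"
        using cramer[OF det_gram_nonzero[OF c chart_inv_in[OF x]]] by simp
    qed
  qed
  moreover have "flat M g X = \<xi>"
  proof (intro ext)
    fix p v
    show "flat M g X p v = \<xi> p v"
    proof (cases "v \<in> tangent_space M p")
      case v: True
      show ?thesis
      proof (cases "p \<in> points M")
        case True
        then show ?thesis using v X by (simp add: flat_def)
      next
        case False
        then have "v = tzero" using v tangent_space_outside by simp
        then show ?thesis using False one_forms_tzero[OF \<xi>] by (simp add: flat_def)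
      qed
    next
      case False
      then show ?thesis using one_forms_not_tangent[OF \<xi>] by (simp add: flat_def)
    qed
  qed
  ultimately show ?thesis using that by blast
qed

lemma sharp_in_vfields: "\<xi> \<in> one_forms M \<Longrightarrow> sharp M g \<xi> \<in> vfields M"
  unfolding sharp_def by (metis flat_surj image_eqI inv_into_into)

lemma flat_sharp: "\<xi> \<in> one_forms M \<Longrightarrow> flat M g (sharp M g \<xi>) = \<xi>"
  unfolding sharp_def by (metis flat_surj image_eqI f_inv_into_f)

lemma sharp_flat: "X \<in> vfields M \<Longrightarrow> sharp M g (flat M g X) = X"
  by (simp add: flat_in_one_forms flat_inj flat_sharp sharp_in_vfields)

lemma flat_add:
  "X \<in> vfields M \<Longrightarrow> Y \<in> vfields M \<Longrightarrow> flat M g (vf_add X Y) = form_add (flat M g X) (flat M g Y)"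
  by (intro ext) (simp add: flat_def vf_add_def form_add_def g_add vfields_tangent)

lemma flat_scale: "X \<in> vfields M \<Longrightarrow> flat M g (vf_scale f X) = form_scale f (flat M g X)"
  by (intro ext) (simp add: flat_def vf_scale_def form_scale_def g_scale vfields_tangent)

lemma sharp_add:
  "\<xi> \<in> one_forms M \<Longrightarrow> \<eta> \<in> one_forms M \<Longrightarrow>
    sharp M g (form_add \<xi> \<eta>) = vf_add (sharp M g \<xi>) (sharp M g \<eta>)"
  by (rule flat_inj) (simp_all add: flat_add flat_sharp sharp_in_vfields vf_add_in_vfields form_add_in_one_forms)

lemma sharp_scale:
  "\<xi> \<in> one_forms M \<Longrightarrow> f \<in> smooth_funs M \<Longrightarrow> sharp M g (form_scale f \<xi>) = vf_scale f (sharp M g \<xi>)"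
  by (rule flat_inj) (simp_all add: flat_scale flat_sharp sharp_in_vfields vf_scale_in_vfields form_scale_in_one_forms)

lemma metric_app_sym:
  "X \<in> vfields M \<Longrightarrow> Y \<in> vfields M \<Longrightarrow> metric_app M g X Y p = metric_app M g Y X p"
  by (simp add: metric_app_def g_sym vfields_tangent)

text \<open>The metric condition for \<open>X\<close> and \<open>J Y\<close>, with
  \<open>J (J Y) = -Y\<close> on the left. So \<open>J\<close> is skew for \<open>g\<close> if
  \<epsilon> = 1 and self-adjoint if \<epsilon> = -1.\<close>

lemma metric_app_J:
  assumes X: "X \<in> vfields M" and Y: "Y \<in> vfields M"
  shows "metric_app M g (J X) Y p = - \<epsilon> * metric_app M g X (J Y) p"
proof -
  have "metric_app M g (J X) (J (J Y)) p = \<epsilon> * metric_app M g X (J Y) p"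
    using metric X J_in[OF Y] by (simp add: metric_manifold_def)
  moreover have "metric_app M g (J X) (J (J Y)) p = - metric_app M g (J X) Y p"
    using vfields_tangent[OF J_in[OF X]] vfields_tangent[OF Y]
    by (simp add: J_J[OF Y] metric_app_def vf_scale_def g_scale)
  ultimately show ?thesis by simp
qed

lemma metric_app_J_swap:
  assumes X: "X \<in> vfields M" and Y: "Y \<in> vfields M"
  shows "metric_app M g Y (J X) p = - \<epsilon> * metric_app M g X (J Y) p"
  using metric_app_J[OF X Y] metric_app_sym[OF Y J_in[OF X]] by simp

section \<open>The two generalized almost complex structures\<close>

abbreviation "Jd \<equiv> dual_endo M J"

lemmas Jd_in = dual_endo(1)[OF J_endo] and Jd_app = dual_endo(2)[OF J_endo]

lemma J_flat_eq:
  "J_flat M \<epsilon> J g (X, \<xi>) = (J X, form_add (flat M g X) (form_scale (\<lambda>p. \<epsilon>) (Jd \<xi>)))"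
  by (simp add: J_flat_def matrix_endo_def vf_add_def tadd_def tzero_def)

lemma J_sharp_eq:
  "J_sharp M \<epsilon> J g (X, \<xi>) = (vf_add (J X) (sharp M g \<xi>), form_scale (\<lambda>p. \<epsilon>) (Jd \<xi>))"
  by (simp add: J_sharp_def matrix_endo_def form_add_def)

lemmas section_intros = J_in Jd_in flat_in_one_forms sharp_in_vfields vf_add_in_vfields
  vf_scale_in_vfields vf_scale_const_in_vfields form_add_in_one_forms form_scale_in_one_forms
  form_scale_const_in_one_forms

lemma gs_endo_J_flat: "gs_endo M (J_flat M \<epsilon> J g)"
  unfolding gs_endo_def
proof (intro conjI ballI)
  fix u assume "u \<in> gsections M"
  then show "J_flat M \<epsilon> J g u \<in> gsections M"
    by (elim gsections_cases) (simp add: J_flat_eq gsections_def section_intros)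
next
  fix u v assume "u \<in> gsections M" "v \<in> gsections M"
  then show "J_flat M \<epsilon> J g (gs_add u v) = gs_add (J_flat M \<epsilon> J g u) (J_flat M \<epsilon> J g v)"
    by (elim gsections_cases)
      (simp add: J_flat_eq gs_add_def vf_endo_add[OF J_endo] flat_add dual_endo_add[OF J_endo],
       simp add: form_add_def form_scale_def algebra_simps)
next
  fix f u assume "f \<in> smooth_funs M" "u \<in> gsections M"
  then show "J_flat M \<epsilon> J g (gs_scale f u) = gs_scale f (J_flat M \<epsilon> J g u)"
    by (elim gsections_cases)
      (simp add: J_flat_eq gs_scale_def vf_endo_scale[OF J_endo] flat_scale dual_endo_scale[OF J_endo],
       simp add: form_add_def form_scale_def algebra_simps)
qed

lemma gs_endo_J_sharp: "gs_endo M (J_sharp M \<epsilon> J g)"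
  unfolding gs_endo_def
proof (intro conjI ballI)
  fix u assume "u \<in> gsections M"
  then show "J_sharp M \<epsilon> J g u \<in> gsections M"
    by (elim gsections_cases) (simp add: J_sharp_eq gsections_def section_intros)
next
  fix u v assume "u \<in> gsections M" "v \<in> gsections M"
  then show "J_sharp M \<epsilon> J g (gs_add u v) = gs_add (J_sharp M \<epsilon> J g u) (J_sharp M \<epsilon> J g v)"
    by (elim gsections_cases)
      (simp add: J_sharp_eq gs_add_def vf_endo_add[OF J_endo] sharp_add dual_endo_add[OF J_endo],
       simp add: form_add_def form_scale_def vf_add_def tadd_def algebra_simps)
next
  fix f u assume "f \<in> smooth_funs M" "u \<in> gsections M"
  then show "J_sharp M \<epsilon> J g (gs_scale f u) = gs_scale f (J_sharp M \<epsilon> J g u)"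
    by (elim gsections_cases)
      (simp add: J_sharp_eq gs_scale_def vf_endo_scale[OF J_endo] sharp_scale dual_endo_scale[OF J_endo],
       simp add: form_scale_def vf_add_def tadd_def vf_scale_def tscale_def algebra_simps)
qed

text \<open>This is \<open>metric_app_J\<close> read as an identity of forms. It makes the
  off-diagonal block \<open>flat J + \<epsilon> Jd flat\<close> in the square of
  \<open>J_flat\<close> vanish.\<close>

lemma flat_J:
  assumes X: "X \<in> vfields M"
  shows "flat M g (J X) = form_scale (\<lambda>p. - \<epsilon>) (Jd (flat M g X))"
proof (rule one_form_eqI)
  fix Y assume Y: "Y \<in> vfields M"
  show "form_app (flat M g (J X)) Y = form_app (form_scale (\<lambda>p. - \<epsilon>) (Jd (flat M g X))) Y"
    using X Y by (intro ext) (simp add: form_app_form_scale Jd_app form_app_flat flat_in_one_forms J_in metric_app_J)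
qed (simp_all add: X section_intros)

text \<open>By duality \<open>Jd\<close> squares to -1. The scalar \<epsilon> stays inside because
  the cotangent block of both structures is \<open>\<epsilon> Jd\<close>.\<close>

lemma Jd_Jd:
  assumes \<xi>: "\<xi> \<in> one_forms M"
  shows "Jd (form_scale (\<lambda>p. \<epsilon>) (Jd \<xi>)) = form_scale (\<lambda>p. - \<epsilon>) \<xi>"
proof (rule one_form_eqI)
  fix X assume X: "X \<in> vfields M"
  show "form_app (Jd (form_scale (\<lambda>p. \<epsilon>) (Jd \<xi>))) X = form_app (form_scale (\<lambda>p. - \<epsilon>) \<xi>) X"
    using \<xi> X by (intro ext) (simp add: form_app_simps Jd_app section_intros J_J)
qed (simp_all add: \<xi> section_intros)

text \<open>The counterpart of \<open>flat_J\<close> for raised indices, checked after applying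
  \<open>flat\<close>. It cancels the off-diagonal block in the square of
  \<open>J_sharp\<close>.\<close>

lemma J_sharp_commute:
  assumes \<xi>: "\<xi> \<in> one_forms M"
  shows "sharp M g (form_scale (\<lambda>p. \<epsilon>) (Jd \<xi>)) = vf_scale (\<lambda>p. -1) (J (sharp M g \<xi>))"
proof (rule flat_inj)
  have "form_scale (\<lambda>p. -1) (form_scale (\<lambda>p. - \<epsilon>) (Jd \<xi>)) = form_scale (\<lambda>p. \<epsilon>) (Jd \<xi>)"
    by (simp add: form_scale_def)
  then show "flat M g (sharp M g (form_scale (\<lambda>p. \<epsilon>) (Jd \<xi>))) =
      flat M g (vf_scale (\<lambda>p. -1) (J (sharp M g \<xi>)))"
    using \<xi> by (simp add: flat_scale flat_J flat_sharp section_intros)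
qed (use \<xi> in \<open>simp_all add: section_intros\<close>)

text \<open>In the form component \<open>flat_J\<close> removes the part coming from
  \<open>X\<close>, and \<open>\<epsilon> * \<epsilon> = 1\<close> leaves -1 on
  \<open>\<xi>\<close>, whichever sign \<epsilon> has.\<close>

lemma gen_almost_complex_J_flat: "gen_almost_complex M (J_flat M \<epsilon> J g)"
  unfolding gen_almost_complex_def
proof (intro conjI ballI gs_endo_J_flat)
  fix u assume "u \<in> gsections M"
  then obtain X \<xi> where u: "u = (X, \<xi>)" and X: "X \<in> vfields M" and \<xi>: "\<xi> \<in> one_forms M"
    by (rule gsections_cases)
  have "form_add (flat M g (J X))
      (form_scale (\<lambda>p. \<epsilon>) (Jd (form_add (flat M g X) (form_scale (\<lambda>p. \<epsilon>) (Jd \<xi>))))) =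
      form_scale (\<lambda>p. -1) \<xi>"
    using X \<xi> eps_sq by (simp add: dual_endo_add[OF J_endo] flat_J Jd_Jd section_intros)
      (simp add: form_add_def form_scale_def algebra_simps flip: mult.assoc)
  then show "J_flat M \<epsilon> J g (J_flat M \<epsilon> J g u) = gs_scale (\<lambda>p. -1) u"
    by (simp add: u J_flat_eq gs_scale_def J_J[OF X])
qed

lemma gen_almost_complex_J_sharp: "gen_almost_complex M (J_sharp M \<epsilon> J g)"
  unfolding gen_almost_complex_def
proof (intro conjI ballI gs_endo_J_sharp)
  fix u assume "u \<in> gsections M"
  then obtain X \<xi> where u: "u = (X, \<xi>)" and X: "X \<in> vfields M" and \<xi>: "\<xi> \<in> one_forms M"
    by (rule gsections_cases)
  have "vf_add (J (vf_add (J X) (sharp M g \<xi>))) (sharp M g (form_scale (\<lambda>p. \<epsilon>) (Jd \<xi>))) =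
      vf_scale (\<lambda>p. -1) X"
    using X \<xi> by (simp add: vf_endo_add[OF J_endo] J_J J_sharp_commute section_intros)
      (simp add: vf_add_def vf_scale_def tadd_def tscale_def)
  moreover have "form_scale (\<lambda>p. \<epsilon>) (Jd (form_scale (\<lambda>p. \<epsilon>) (Jd \<xi>))) = form_scale (\<lambda>p. -1) \<xi>"
    using \<xi> eps_sq by (simp add: Jd_Jd) (simp add: form_scale_def flip: mult.assoc)
  ultimately show "J_sharp M \<epsilon> J g (J_sharp M \<epsilon> J g u) = gs_scale (\<lambda>p. -1) u"
    by (simp add: u J_sharp_eq gs_scale_def)
qed

section \<open>Compatibility with G0 and twin metrics\<close>

text \<open>The cross terms \<open>g(X, JY) + g(Y, JX)\<close> combine by
  \<open>metric_app_J_swap\<close>. In the other terms duality moves a second \<open>J\<close> onto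
  the vector, and \<open>J (J X) = -X\<close> gives the factor \<open>- \<epsilon>\<close>.\<close>

lemma G0_J_flat:
  assumes "X \<in> vfields M" "Y \<in> vfields M" "\<xi> \<in> one_forms M" "\<eta> \<in> one_forms M"
  shows "G0 (J_flat M \<epsilon> J g (X, \<xi>)) (J_flat M \<epsilon> J g (Y, \<eta>)) p =
    (1 - \<epsilon>) / 2 * metric_app M g X (J Y) p - \<epsilon> * G0 (X, \<xi>) (Y, \<eta>) p"
  using assms by (simp add: J_flat_eq G0_def form_app_simps Jd_app section_intros form_app_flat J_J
      metric_app_J_swap[of X Y] field_simps)

text \<open>The extra factor \<epsilon> compared with \<open>G0_J_flat\<close> arises because here
  the cross terms come out of the block \<open>\<epsilon> Jd\<close>. Writing each form as
  \<open>g\<close> applied to its raised field makes the swap rule for \<open>g\<close>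
  available.\<close>

lemma G0_J_sharp:
  assumes "X \<in> vfields M" "Y \<in> vfields M" "\<xi> \<in> one_forms M" "\<eta> \<in> one_forms M"
  shows "G0 (J_sharp M \<epsilon> J g (X, \<xi>)) (J_sharp M \<epsilon> J g (Y, \<eta>)) p =
    \<epsilon> * (1 - \<epsilon>) / 2 * metric_app M g (sharp M g \<xi>) (J (sharp M g \<eta>)) p - \<epsilon> * G0 (X, \<xi>) (Y, \<eta>) p"
proof -
  have eq: "form_app \<zeta> Z p = metric_app M g (sharp M g \<zeta>) Z p"
    if "\<zeta> \<in> one_forms M" "Z \<in> vfields M" for \<zeta> Z
    using form_app_flat[OF that(2), of "sharp M g \<zeta>"] flat_sharp[OF that(1)] by simp
  have swap: "form_app \<eta> (J (sharp M g \<xi>)) p = - \<epsilon> * form_app \<xi> (J (sharp M g \<eta>)) p"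
    using assms metric_app_J_swap[of "sharp M g \<xi>" "sharp M g \<eta>" p] by (simp add: eq section_intros)
  have "G0 (J_sharp M \<epsilon> J g (X, \<xi>)) (J_sharp M \<epsilon> J g (Y, \<eta>)) p =
    \<epsilon> * (1 - \<epsilon>) / 2 * form_app \<xi> (J (sharp M g \<eta>)) p - \<epsilon> * G0 (X, \<xi>) (Y, \<eta>) p"
    using assms by (simp add: J_sharp_eq G0_def form_app_simps Jd_app section_intros J_J
        vf_endo_add[OF J_endo] swap field_simps)
  then show ?thesis using assms by (simp add: eq section_intros)
qed

text \<open>Since \<open>Y = - J (J Y)\<close>, vanishing of all \<open>g(X, JY)\<close> would make
  a nonzero vector orthogonal to its whole tangent space.\<close>

lemma not_all_metric_app_J_zero:
  assumes "points M \<noteq> {}"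
  shows "\<exists>X\<in>vfields M. \<exists>Y\<in>vfields M. \<exists>p. metric_app M g X (J Y) p \<noteq> 0"
proof (rule ccontr)
  assume none: "\<not> ?thesis"
  obtain p c where p: "p \<in> points M" and c: "c \<in> atlas M" "p \<in> fst c"
    using assms chart_at_point by blast
  \<comment> \<open>An arbitrary coordinate axis; the index type is inhabited, which is where
    positive dimension enters.\<close>
  let ?v = "coord_vec M c p (axis undefined 1)"
  have v: "?v \<in> tangent_space M p" "?v c = axis undefined 1"
    using c by (simp_all add: coord_vec_in_tangent_space coord_vec_self)
  obtain X where X: "X \<in> vfields M" "X p = ?v" using v(1) by (rule vfield_through)
  have "g p ?v w = 0" if w: "w \<in> tangent_space M p" for w
  proof -
    obtain Y where Y: "Y \<in> vfields M" "Y p = w" using w by (rule vfield_through)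
    have "metric_app M g X (J (J Y)) p = 0"
      using none X J_in[OF Y(1)] by blast
    then show ?thesis
      using p Y v(1) X w by (simp add: J_J metric_app_def vf_scale_def g_scale)
  qed
  then have "?v = tzero" using p v(1) by (intro g_nondegenerate)
  then show False using v(2) by (simp add: tzero_def axis_eq_0_iff)
qed

lemma compatible_J_flat_imp:
  assumes "points M \<noteq> {}" "compatible M (J_flat M \<epsilon> J g) G0"
  shows "\<epsilon> = 1"
proof (rule ccontr)
  assume "\<epsilon> \<noteq> 1"
  obtain X Y p where XY: "X \<in> vfields M" "Y \<in> vfields M" "metric_app M g X (J Y) p \<noteq> 0"
    using not_all_metric_app_J_zero[OF assms(1)] by blast
  obtain \<delta> where "\<And>u v. u \<in> gsections M \<Longrightarrow> v \<in> gsections M \<Longrightarrow>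
      G0 (J_flat M \<epsilon> J g u) (J_flat M \<epsilon> J g v) = (\<lambda>p. \<delta> * G0 u v p)"
    using assms(2) by (auto simp: compatible_def)
  \<comment> \<open>Both sections are pure fields, so \<open>G0\<close> of them is 0 and the unknown
    \<delta> drops out.\<close>
  from fun_cong[OF this[of "(X, \<lambda>p v. 0)" "(Y, \<lambda>p v. 0)"], of p]
  have "(1 - \<epsilon>) * metric_app M g X (J Y) p = 0"
    using XY by (simp add: gsections_def zero_in_one_forms G0_J_flat) (simp add: G0_def form_app_def)
  then show False using XY(3) \<open>\<epsilon> \<noteq> 1\<close> by simp
qed

lemma compatible_J_sharp_imp:
  assumes "points M \<noteq> {}" "compatible M (J_sharp M \<epsilon> J g) G0"
  shows "\<epsilon> = 1"
proof (rule ccontr)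
  assume "\<epsilon> \<noteq> 1"
  obtain X Y p where XY: "X \<in> vfields M" "Y \<in> vfields M" "metric_app M g X (J Y) p \<noteq> 0"
    using not_all_metric_app_J_zero[OF assms(1)] by blast
  obtain \<delta> where "\<And>u v. u \<in> gsections M \<Longrightarrow> v \<in> gsections M \<Longrightarrow>
      G0 (J_sharp M \<epsilon> J g u) (J_sharp M \<epsilon> J g v) = (\<lambda>p. \<delta> * G0 u v p)"
    using assms(2) by (auto simp: compatible_def)
  \<comment> \<open>Pure forms, taken as lowered fields so that \<open>sharp\<close> recovers
    exactly \<open>X\<close> and \<open>Y\<close>; again \<delta> is multiplied by 0.\<close>
  from fun_cong[OF this[of "(\<lambda>p. tzero, flat M g X)" "(\<lambda>p. tzero, flat M g Y)"], of p]
  have "\<epsilon> * (1 - \<epsilon>) * metric_app M g X (J Y) p = 0"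
    using XY by (simp add: gsections_def zero_in_vfields flat_in_one_forms G0_J_sharp sharp_flat)
      (simp add: G0_def form_app_def one_forms_tzero flat_in_one_forms)
  then show False using XY(3) \<open>\<epsilon> \<noteq> 1\<close> eps_sq by auto
qed

lemma norden_J_flat:
  assumes "\<epsilon> = 1"
  shows "gen_almost_norden M (J_flat M \<epsilon> J g) G0"
  unfolding gen_almost_norden_def
proof (intro conjI ballI gen_almost_complex_J_flat gen_metric_G0 ext)
  fix u v p assume "u \<in> gsections M" "v \<in> gsections M"
  then show "G0 (J_flat M \<epsilon> J g u) (J_flat M \<epsilon> J g v) p = - G0 u v p"
    by (elim gsections_cases) (simp only: G0_J_flat, simp add: assms)
qed

lemma norden_J_sharp:
  assumes "\<epsilon> = 1"
  shows "gen_almost_norden M (J_sharp M \<epsilon> J g) G0"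
  unfolding gen_almost_norden_def
proof (intro conjI ballI gen_almost_complex_J_sharp gen_metric_G0 ext)
  fix u v p assume "u \<in> gsections M" "v \<in> gsections M"
  then show "G0 (J_sharp M \<epsilon> J g u) (J_sharp M \<epsilon> J g v) p = - G0 u v p"
    by (elim gsections_cases) (simp only: G0_J_sharp, simp add: assms)
qed

text \<open>\<open>Jd\<close> transfers \<open>J\<close> from \<open>\<xi>\<close> to
  \<open>Y\<close>, so for \<epsilon> = 1 the two terms free of \<open>g\<close> are exactly those
  of \<open>G0 (J X, \<xi>) (J Y, \<eta>)\<close>. The block \<open>flat\<close> contributes the
  remaining one.\<close>

lemma twin_J_flat:
  assumes "\<epsilon> = 1" "X \<in> vfields M" "Y \<in> vfields M" "\<xi> \<in> one_forms M" "\<eta> \<in> one_forms M"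
  shows "twin_metric (J_flat M \<epsilon> J g) G0 (X, \<xi>) (Y, \<eta>) =
    (\<lambda>p. G0 (J X, \<xi>) (J Y, \<eta>) p + 1 / 2 * metric_app M g X Y p)"
  unfolding twin_metric_def J_flat_eq using assms by (intro ext)
    (simp add: G0_def form_app_simps Jd_app form_app_flat algebra_simps)

lemma twin_J_sharp:
  assumes "\<epsilon> = 1" "X \<in> vfields M" "Y \<in> vfields M" "\<xi> \<in> one_forms M" "\<eta> \<in> one_forms M"
  shows "twin_metric (J_sharp M \<epsilon> J g) G0 (X, \<xi>) (Y, \<eta>) =
    (\<lambda>p. G0 (J X, \<xi>) (J Y, \<eta>) p + 1 / 2 * metric_app M g (sharp M g \<xi>) (sharp M g \<eta>) p)"
proof
  fix p
  \<comment> \<open>The block \<open>sharp\<close> contributes \<open>\<eta> (sharp \<xi>)\<close>;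
    writing \<open>\<eta>\<close> as \<open>flat (sharp \<eta>)\<close> and using symmetry of
    \<open>g\<close> gives the stated term.\<close>
  have "form_app \<eta> (sharp M g \<xi>) p = metric_app M g (sharp M g \<xi>) (sharp M g \<eta>) p"
    using form_app_flat[of "sharp M g \<xi>" "sharp M g \<eta>"] assms
      metric_app_sym[of "sharp M g \<xi>" "sharp M g \<eta>" p]
    by (simp add: flat_sharp sharp_in_vfields)
  then show "twin_metric (J_sharp M \<epsilon> J g) G0 (X, \<xi>) (Y, \<eta>) p =
      G0 (J X, \<xi>) (J Y, \<eta>) p + 1 / 2 * metric_app M g (sharp M g \<xi>) (sharp M g \<eta>) p"
    unfolding twin_metric_def J_sharp_eq using assms
    by (simp add: G0_def form_app_simps Jd_app section_intros algebra_simps)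
qed

text \<open>The Hermitian notions fix the sign 1 while \<open>metric_manifold\<close> carries
  \<epsilon> as a parameter, so \<epsilon> must be recovered from \<open>(M, J, g)\<close>. Both
  signs satisfy \<open>metric_app_J\<close>; they are compared where \<open>g(X, JY)\<close> is
  nonzero. On an empty manifold either sign would do.\<close>

lemma hermitian_imp:
  assumes "points M \<noteq> {}" "metric_manifold (-1) 1 M J g"
  shows "\<epsilon> = 1"
proof -
  interpret H: metric_mfd M 1 J g
    using assms(2) by unfold_locales
  obtain X Y p where XY: "X \<in> vfields M" "Y \<in> vfields M" "metric_app M g X (J Y) p \<noteq> 0"
    using not_all_metric_app_J_zero[OF assms(1)] by blast
  then show ?thesis
    using metric_app_J[OF XY(1,2), of p] H.metric_app_J[OF XY(1,2), of p] by simp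
qed

end

theorem proposition4p9:
  fixes M :: "('a, 'n::finite) manifold"
    and J :: "('a, 'n) vfield \<Rightarrow> ('a, 'n) vfield"
    and g :: "('a, 'n) tensor2"
    and \<alpha> \<epsilon> :: real
  assumes "smooth_manifold M"
    and "points M \<noteq> {}"
    and "metric_manifold \<alpha> \<epsilon> M J g"
    and "\<alpha> = -1"
  shows "gen_almost_complex M (J_flat M \<epsilon> J g) \<and> gen_almost_complex M (J_sharp M \<epsilon> J g) \<and>
    (compatible M (J_flat M \<epsilon> J g) G0 \<longleftrightarrow> \<epsilon> = 1) \<and>
    (compatible M (J_sharp M \<epsilon> J g) G0 \<longleftrightarrow> \<epsilon> = 1) \<and>
    (\<epsilon> = 1 \<longleftrightarrow> almost_hermitian M J g \<or> indefinite_almost_hermitian M J g) \<and>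
    (riemannian M g \<longrightarrow> (\<epsilon> = 1 \<longleftrightarrow> almost_hermitian M J g)) \<and>
    (pseudo_riemannian M g \<longrightarrow> (\<epsilon> = 1 \<longleftrightarrow> indefinite_almost_hermitian M J g)) \<and>
    (\<epsilon> = 1 \<longrightarrow>
      gen_almost_norden M (J_flat M \<epsilon> J g) G0 \<and>
      gen_almost_norden M (J_sharp M \<epsilon> J g) G0 \<and>
      (\<forall>X\<in>vfields M. \<forall>Y\<in>vfields M. \<forall>\<xi>\<in>one_forms M. \<forall>\<eta>\<in>one_forms M.
        twin_metric (J_flat M \<epsilon> J g) G0 (X, \<xi>) (Y, \<eta>) =
          (\<lambda>p. G0 (J X, \<xi>) (J Y, \<eta>) p + 1 / 2 * metric_app M g X Y p) \<and>
        twin_metric (J_sharp M \<epsilon> J g) G0 (X, \<xi>) (Y, \<eta>) =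
          (\<lambda>p. G0 (J X, \<xi>) (J Y, \<eta>) p
            + 1 / 2 * metric_app M g (sharp M g \<xi>) (sharp M g \<eta>) p)))"
proof -
  interpret metric_mfd M \<epsilon> J g
    using assms by unfold_locales auto
  have herm: "metric_manifold (-1) 1 M J g \<longleftrightarrow> \<epsilon> = 1"
    using hermitian_imp[OF assms(2)] metric by auto
  have type: "riemannian M g \<or> pseudo_riemannian M g"
    using metric by (simp add: metric_manifold_def)
  have "compatible M (J_flat M \<epsilon> J g) G0 \<longleftrightarrow> \<epsilon> = 1"
    using compatible_J_flat_imp[OF assms(2)] norden_J_flat norden_imp_compatible by blast
  moreover have "compatible M (J_sharp M \<epsilon> J g) G0 \<longleftrightarrow> \<epsilon> = 1"
    using compatible_J_sharp_imp[OF assms(2)] norden_J_sharp norden_imp_compatible by blast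
  moreover have "\<epsilon> = 1 \<longleftrightarrow> almost_hermitian M J g \<or> indefinite_almost_hermitian M J g"
    "riemannian M g \<longrightarrow> (\<epsilon> = 1 \<longleftrightarrow> almost_hermitian M J g)"
    "pseudo_riemannian M g \<longrightarrow> (\<epsilon> = 1 \<longleftrightarrow> indefinite_almost_hermitian M J g)"
    unfolding almost_hermitian_def indefinite_almost_hermitian_def herm using type by blast+
  ultimately show ?thesis
    using gen_almost_complex_J_flat gen_almost_complex_J_sharp norden_J_flat norden_J_sharp
      twin_J_flat twin_J_sharp by blast
qed

end
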